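(* Let $\alpha\in(0,2)$ and let $Z=\{Z_t,\ t\ge0\}$ be a real symmetric $\alpha$-stable Lévy process with $\mathbb E[e^{i\lambda Z_t}]=e^{-\kappa t|\lambda|^\alpha}$ for all $t\ge0$, $\lambda\in\mathbb R$, where $\kappa>0$. Set $\|Z\|_\infty=\sup_{0\le t\le1}|Z_t|$, $\|Z\|_\omega=\sup_{0\le s<t\le1}|Z_t-Z_s|$, and $$\mathcal K_{\alpha,\infty}=-\lim_{\varepsilon\downarrow0}\varepsilon^\alpha\log\mathbb P[\|Z\|_\infty\le\varepsilon],\qquad \mathcal K_{\alpha,\omega}=-\lim_{\varepsilon\downarrow0}\varepsilon^\alpha\log\mathbb P[\|Z\|_\omega\le\varepsilon].$$ Let $$\gamma_\alpha=2^{\alpha/2}\kappa\,\inf_{f\in\mathcal A}\int_{\mathbb R}|x|^\alpha f(x)\,dx,\qquad d_\alpha=\left(\frac{2-\alpha}{2}\right)\alpha^{\frac{\alpha}{2-\alpha}}\kappa^{\frac{2}{2-\alpha}},$$ where $\mathcal A$ is the set of absolutely continuous probability densities $f$ on $\mathbb R$ with $\frac18\int_{\mathbb R}\frac{(f'(x))^2}{f(x)}\,dx\le1$. Then $$\gamma_\alpha\le\mathcal K_{\alpha,\infty}\le\frac{\pi^2}{8}+d_\alpha\qquad\text{and}\qquad\mathcal K_{\alpha,\infty}\le\mathcal K_{\alpha,\omega}\le\frac{\pi^2}{2}+d_\alpha.$$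
   Context: $Z$ starts from $0$ and a càdlàg version is used. The limits defining $\mathcal K_{\alpha,\infty}$ and $\mathcal K_{\alpha,\omega}$ are known to exist, with a priori $\mathcal K_{\alpha,\infty}\in(0,\infty)$ and $\mathcal K_{\alpha,\omega}\in(0,\infty]$. It is a known result (Shi) that $$\lim_{\varepsilon\downarrow0}\varepsilon^\alpha\log\mathbb P\left[\left(\int_0^1Z_t^2\,dt\right)^{1/2}\le\varepsilon\right]=-\gamma_\alpha.$$ *)

theory Defs
  imports "HOL-Probability.Probability"
begin

definition cadlag :: "(real \<Rightarrow> real) \<Rightarrow> bool" where
  "cadlag f \<longleftrightarrow>
     (\<forall>t\<ge>0. (f \<longlongrightarrow> f t) (at_right t)) \<and>
     (\<forall>t>0. \<exists>l. (f \<longlongrightarrow> l) (at_left t))"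

(* The time set is [0, \<infinity>); the values at negative times are irrelevant.  All paths, not
   just almost all of them, start from 0 and are cadlag, so that the sets whose probabilities
   are taken below are events even if M is not complete. *)
definition levy_process :: "'a measure \<Rightarrow> (real \<Rightarrow> 'a \<Rightarrow> real) \<Rightarrow> bool" where
  "levy_process M Z \<longleftrightarrow>
     prob_space M \<and>
     (\<forall>t\<ge>0. Z t \<in> borel_measurable M) \<and>
     (\<forall>\<omega>\<in>space M. Z 0 \<omega> = 0) \<and>
     (\<forall>\<omega>\<in>space M. cadlag (\<lambda>t. Z t \<omega>)) \<and>
     (\<forall>s t. 0 \<le> s \<and> s \<le> t \<longrightarrow>
        distr M borel (\<lambda>\<omega>. Z t \<omega> - Z s \<omega>) = distr M borel (Z (t - s))) \<and>
     (\<forall>(n::nat) (\<tau>::nat \<Rightarrow> real). 0 \<le> \<tau> 0 \<and> mono \<tau> \<longrightarrow>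
        prob_space.indep_vars M (\<lambda>_. borel) (\<lambda>i \<omega>. Z (\<tau> (Suc i)) \<omega> - Z (\<tau> i) \<omega>) {..<n})"

definition stable_levy_process ::
  "'a measure \<Rightarrow> (real \<Rightarrow> 'a \<Rightarrow> real) \<Rightarrow> real \<Rightarrow> real \<Rightarrow> bool" where
  "stable_levy_process M Z \<alpha> \<kappa> \<longleftrightarrow>
     levy_process M Z \<and>
     (\<forall>t\<ge>0. \<forall>\<xi>. char (distr M borel (Z t)) \<xi> =
        complex_of_real (exp (- \<kappa> * t * \<bar>\<xi>\<bar> powr \<alpha>)))"

(* The suprema are taken in ereal, since a real-valued SUP is unspecified on unbounded sets. *)
definition sup_norm :: "(real \<Rightarrow> 'a \<Rightarrow> real) \<Rightarrow> 'a \<Rightarrow> ereal" where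
  "sup_norm Z \<omega> = (SUP t\<in>{0..1}. ereal \<bar>Z t \<omega>\<bar>)"

definition oscillation :: "(real \<Rightarrow> 'a \<Rightarrow> real) \<Rightarrow> 'a \<Rightarrow> ereal" where
  "oscillation Z \<omega> = (SUP (s, t)\<in>{(s, t). 0 \<le> s \<and> s < t \<and> t \<le> 1}. ereal \<bar>Z t \<omega> - Z s \<omega>\<bar>)"

definition L2_path_norm :: "(real \<Rightarrow> 'a \<Rightarrow> real) \<Rightarrow> 'a \<Rightarrow> ereal" where
  "L2_path_norm Z \<omega> = ereal (sqrt (LINT t:{0..1}|lborel. (Z t \<omega>)\<^sup>2))"

(* Logarithm of a probability, with log 0 = -\<infinity>; the library's ln is real-valued at 0. *)
definition log_prob :: "real \<Rightarrow> ereal" where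
  "log_prob p = (if p = 0 then - \<infinity> else ereal (ln p))"

definition scaled_log_small_ball :: "'a measure \<Rightarrow> real \<Rightarrow> ('a \<Rightarrow> ereal) \<Rightarrow> real \<Rightarrow> ereal" where
  "scaled_log_small_ball M \<alpha> N \<epsilon> =
     ereal (\<epsilon> powr \<alpha>) * log_prob (measure M {\<omega> \<in> space M. N \<omega> \<le> ereal \<epsilon>})"

(* Lim is a definite description: the constant is meaningful only where the limit exists. *)
definition small_ball_constant :: "'a measure \<Rightarrow> real \<Rightarrow> ('a \<Rightarrow> ereal) \<Rightarrow> ereal" where
  "small_ball_constant M \<alpha> N = - Lim (at_right 0) (scaled_log_small_ball M \<alpha> N)"

definition K_infinity :: "'a measure \<Rightarrow> real \<Rightarrow> (real \<Rightarrow> 'a \<Rightarrow> real) \<Rightarrow> ereal" where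
  "K_infinity M \<alpha> Z = small_ball_constant M \<alpha> (sup_norm Z)"

definition K_omega :: "'a measure \<Rightarrow> real \<Rightarrow> (real \<Rightarrow> 'a \<Rightarrow> real) \<Rightarrow> ereal" where
  "K_omega M \<alpha> Z = small_ball_constant M \<alpha> (oscillation Z)"

definition absolutely_continuous_fun :: "(real \<Rightarrow> real) \<Rightarrow> bool" where
  "absolutely_continuous_fun f \<longleftrightarrow>
     (\<forall>e>0. \<exists>d>0. \<forall>(n::nat) (a::nat \<Rightarrow> real) (b::nat \<Rightarrow> real).
        (\<forall>i<n. a i \<le> b i) \<and>
        (\<forall>i<n. \<forall>j<n. i \<noteq> j \<longrightarrow> {a i<..<b i} \<inter> {a j<..<b j} = {}) \<and>
        (\<Sum>i<n. b i - a i) < d \<longrightarrow>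
        (\<Sum>i<n. \<bar>f (b i) - f (a i)\<bar>) < e)"

(* Such an f is differentiable almost everywhere, so the arbitrary value of deriv f elsewhere does
   not matter.  Where f vanishes and is differentiable, it has a minimum, so f' = 0 there, and the
   library's x / 0 = 0 gives the usual convention 0 / 0 = 0.  Finiteness of the Fisher information
   makes f' integrable, so it is immaterial whether absolute continuity is required on the whole
   line or only on compact intervals. *)
definition fisher_densities :: "(real \<Rightarrow> real) set" where
  "fisher_densities = {f.
     (\<forall>x. 0 \<le> f x) \<and>
     (\<integral>\<^sup>+x. ennreal (f x) \<partial>lborel) = 1 \<and>
     absolutely_continuous_fun f \<and>
     ennreal (1/8) * (\<integral>\<^sup>+x. ennreal ((deriv f x)\<^sup>2 / f x) \<partial>lborel) \<le> 1}"

definition gamma_const :: "real \<Rightarrow> real \<Rightarrow> ereal" where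
  "gamma_const \<alpha> \<kappa> = ereal (2 powr (\<alpha>/2) * \<kappa>) *
     (INF f\<in>fisher_densities. enn2ereal (\<integral>\<^sup>+x. ennreal (\<bar>x\<bar> powr \<alpha> * f x) \<partial>lborel))"

definition d_const :: "real \<Rightarrow> real \<Rightarrow> real" where
  "d_const \<alpha> \<kappa> = ((2 - \<alpha>) / 2) * \<alpha> powr (\<alpha> / (2 - \<alpha>)) * \<kappa> powr (2 / (2 - \<alpha>))"

end

theory Submission
  imports Defs "HOL-Real_Asymp.Real_Asymp"
begin

text \<open>The lower bound is the inequality of the \<open>L\<^sup>2\<close> norm and the supremum norm.  For the upper
  bounds, let \<open>\<phi>(x) = cos (\<pi> x / (2 r))\<close> on \<open>[-r, r]\<close> and \<open>\<phi> = 0\<close> outside.  If \<open>\<mu>\<close> is a symmetric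
  uniform law, then \<open>\<integral> \<phi>(x + y) d\<mu>(y) \<ge> l \<phi>(x)\<close>, where \<open>l\<close> is the value at \<open>\<pi> / (2 r)\<close> of the
  characteristic function.  This inequality passes to mixtures, to convolutions (for \<open>l \<ge> 0\<close>) and
  to weak limits, hence to the symmetric stable law, which is a limit of normalised sums of
  Pareto mixtures of uniform laws.  Iterating it along the increments of \<open>Z\<close> on a dyadic grid
  gives \<open>P(sup |Z| \<le> r) \<ge> exp (- \<kappa> (\<pi> / (2 r))\<^sup>\<alpha>)\<close> for every \<open>r > 0\<close>, and Young's inequality
  \<open>\<kappa> a\<^sup>\<alpha> \<le> a\<^sup>2 / 2 + d\<^sub>\<alpha>\<close> with \<open>a = \<pi> / 2\<close> and, since \<open>sup |Z| \<le> \<epsilon> / 2\<close> forces an oscillation of at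
  most \<open>\<epsilon>\<close>, with \<open>a = \<pi>\<close> concludes.\<close>

section \<open>The truncated cosine and uniform laws\<close>

text \<open>For \<open>0 < r\<close> this is the positive Dirichlet eigenfunction of the second
  derivative on \<open>[-r, r]\<close>; \<open>cos_excessive\<close> evaluates characteristic
  functions at its frequency \<open>pi / (2 * r)\<close>.\<close>

definition cos_bump :: "real \<Rightarrow> real \<Rightarrow> real" where
  "cos_bump r x = (if \<bar>x\<bar> \<le> r then cos (pi / (2 * r) * x) else 0)"

text \<open>The cosine vanishes at the ends of \<open>[-r, r]\<close>, so freezing its argument
  there replaces the case distinction by a composition of continuous maps.\<close>

lemma cos_bump_clamp:
  assumes "0 < r"
  shows "cos_bump r x = cos (pi / (2 * r) * max (- r) (min r x))"
proof -
  have "pi / (2 * r) * r = pi / 2" using assms by simp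
  then show ?thesis
    unfolding cos_bump_def using assms
    by (auto simp: max_def min_def abs_if split: if_splits)
qed

lemma continuous_cos_bump:
  assumes "0 < r"
  shows "continuous_on A (cos_bump r)"
  unfolding cos_bump_clamp[OF assms, abs_def] by (intro continuous_intros)

lemma borel_measurable_cos_bump [measurable]: "cos_bump r \<in> borel_measurable borel"
  unfolding cos_bump_def[abs_def] by measurable

lemma cos_bump_nonneg: "0 \<le> cos_bump r x"
proof (cases "0 < r \<and> \<bar>x\<bar> \<le> r")
  case True
  then have "\<bar>pi / (2 * r) * x\<bar> \<le> pi / (2 * r) * r"
    unfolding abs_mult by (intro mult_mono) auto
  also have "\<dots> = pi / 2" using True by simp
  finally have "0 \<le> cos (pi / (2 * r) * x)"
    by (intro cos_ge_zero) linarith+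
  then show ?thesis
    unfolding cos_bump_def by simp
\<comment> \<open>For \<open>r < 0\<close> the bump is identically 0; for \<open>r = 0\<close>
  division by zero makes the frequency 0, and the value at 0 is \<open>cos 0 = 1\<close>.\<close>
qed (cases "r = 0"; auto simp: cos_bump_def)

lemma cos_bump_le_1: "cos_bump r x \<le> 1"
  unfolding cos_bump_def by simp

lemma abs_cos_bump_le_1: "\<bar>cos_bump r x\<bar> \<le> 1"
  using cos_bump_nonneg[of r x] cos_bump_le_1[of r x] by simp

abbreviation symmetric_uniform :: "real measure" where
  "symmetric_uniform \<equiv> uniform_measure lborel {-1..1}"

interpretation symmetric_uniform: prob_space symmetric_uniform
  by (rule prob_space_uniform_measure) auto

lemma integral_symmetric_uniform:
  fixes f :: "real \<Rightarrow> 'b::euclidean_space"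
  assumes f: "continuous_on {-1..1} f" "f \<in> borel_measurable borel"
    and I: "(f has_integral I) {-1..1}"
  shows "integral\<^sup>L symmetric_uniform f = I /\<^sub>R 2"
proof -
  have eq: "symmetric_uniform = density lborel (\<lambda>x. ennreal (indicator {-1..1} x / 2))"
    unfolding uniform_measure_def
    by (intro density_cong) (auto split: split_indicator simp: divide_ennreal_def ennreal_divide_numeral simp flip: ennreal_numeral inverse_ennreal)
  have "integral\<^sup>L symmetric_uniform f = (\<integral>x. (indicator {-1..1} x / 2) *\<^sub>R f x \<partial>lborel)"
    unfolding eq using f by (subst integral_density) auto
  also have "\<dots> = (\<integral>x. (1/2) *\<^sub>R (indicator {-1..1} x *\<^sub>R f x) \<partial>lborel)"
    by (rule Bochner_Integration.integral_cong) auto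
  also have "\<dots> = (LINT x:{-1..1}|lborel. f x) /\<^sub>R 2"
    by (simp only: set_lebesgue_integral_def integral_scaleR_right) (simp add: inverse_eq_divide)
  also have "(LINT x:{-1..1}|lborel. f x) = I"
    using set_borel_integral_eq_integral(2)[OF borel_integrable_atLeastAtMost'[OF f(1)]] I
    by (simp add: integral_unique)
  finally show ?thesis .
qed

lemma integral_uniform_iexp: "(CLINT u|symmetric_uniform. iexp (a * u)) = complex_of_real (sinc a)"
proof (cases "a = 0")
  case False
  define F where "F = (\<lambda>u::real. iexp (a * u) / (\<i> * a))"
  have "((\<lambda>u. iexp (a * u)) has_integral (F 1 - F (-1))) {-1..1}"
  proof (rule fundamental_theorem_of_calculus)
    show "(F has_vector_derivative iexp (a * u)) (at u within {-1..1})" for u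
    proof -
      have "((\<lambda>z. exp (\<i> * (a * z)) / (\<i> * a)) has_field_derivative iexp (a * u)) (at (of_real u))"
        using False by (auto intro!: derivative_eq_intros simp: field_simps)
      then show ?thesis
        unfolding F_def using has_vector_derivative_real_field by fastforce
    qed
  qed simp
  moreover have "F 1 - F (-1) = of_real (2 * (sin a / a))"
    unfolding F_def using False by (simp add: exp_Euler exp_minus_Euler field_simps sin_of_real cos_of_real)
  ultimately show ?thesis using False
    by (subst integral_symmetric_uniform) (auto intro!: continuous_intros borel_measurable_continuous_onI simp: scaleR_conv_of_real mult_ac)
qed (simp add: symmetric_uniform.prob_space)

text \<open>Averaging the full cosine over \<open>[x - a, x + a]\<close> multiplies it exactly by
  the \<open>sinc\<close> factor. For \<open>\<bar>x\<bar> \<le> r\<close> truncation can only raise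
  this average: beyond \<open>r\<close> the cosine is not everywhere negative, but its integral from
  \<open>r\<close> to any later point is at most 0, and symmetrically on the left. Hence primitives
  are compared instead of integrands.\<close>

lemma uniform_cos_bump_ge:
  assumes "0 < r" "0 < a"
  shows "sinc (pi / (2 * r) * a) * cos_bump r x \<le> (\<integral>u. cos_bump r (x + a * u) \<partial>symmetric_uniform)"
proof (cases "\<bar>x\<bar> \<le> r")
  case False
  then show ?thesis
    by (simp add: cos_bump_def Bochner_Integration.integral_nonneg cos_bump_nonneg[unfolded cos_bump_def])
next
  case x: True
  define \<xi> where "\<xi> = pi / (2 * r)"
  have \<xi>: "0 < \<xi>" "\<xi> * r = pi / 2" using assms by (auto simp: \<xi>_def)
  \<comment> \<open>A primitive of \<open>cos_bump r\<close>: the clamp keeps it constant outside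
    \<open>[-r, r]\<close>.\<close>
  define \<Phi> where "\<Phi> z = sin (\<xi> * max (- r) (min r z)) / \<xi>" for z
  define F where "F u = \<Phi> (x + a * u) / a" for u
  have "((\<lambda>u. cos_bump r (x + a * u)) has_integral (F 1 - F (-1))) {-1..1}"
  \<comment> \<open>The exceptional points are the \<open>u\<close> at which
    \<open>x + a * u\<close> reaches an end of \<open>[-r, r]\<close>, where the formula for
    \<open>\<Phi>\<close> changes.\<close>
  proof (rule fundamental_theorem_of_calculus_interior_strong[where S="{(r - x) / a, (- r - x) / a}"])
    fix u assume "u \<in> {-1<..<1} - {(r - x) / a, (- r - x) / a}"
    then have ne: "x + a * u \<noteq> r" "x + a * u \<noteq> - r" using assms by (auto simp: field_simps)
    have \<Phi>: "(\<Phi> has_real_derivative cos_bump r z) (at z)" if zne: "z \<noteq> r" "z \<noteq> - r" for z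
    proof -
      consider "z < - r" | "\<bar>z\<bar> < r" | "r < z" using zne by linarith
      then show ?thesis
      proof cases
        case 1
        have "((\<lambda>_. sin (\<xi> * - r) / \<xi>) has_real_derivative 0) (at z)" by simp
        then have "(\<Phi> has_real_derivative 0) (at z)"
          by (rule has_field_derivative_transform_within_open[where S="{..<-r}"]) (use 1 in \<open>auto simp: \<Phi>_def\<close>)
        then show ?thesis using 1 assms by (simp add: cos_bump_def)
      next
        case 2
        have "((\<lambda>z. sin (\<xi> * z) / \<xi>) has_real_derivative cos (\<xi> * z)) (at z)"
          using \<xi> by (auto intro!: derivative_eq_intros)
        then have "(\<Phi> has_real_derivative cos (\<xi> * z)) (at z)"
          by (rule has_field_derivative_transform_within_open[where S="{-r<..<r}"]) (use 2 in \<open>auto simp: \<Phi>_def\<close>)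
        then show ?thesis using 2 assms by (simp add: cos_bump_def \<xi>_def)
      next
        case 3
        have "((\<lambda>_. sin (\<xi> * r) / \<xi>) has_real_derivative 0) (at z)" by simp
        then have "(\<Phi> has_real_derivative 0) (at z)"
          by (rule has_field_derivative_transform_within_open[where S="{r<..}"]) (use 3 assms in \<open>auto simp: \<Phi>_def\<close>)
        then show ?thesis using 3 assms by (simp add: cos_bump_def)
      qed
    qed
    have *: "((\<lambda>u. \<Phi> (x + a * u)) has_real_derivative cos_bump r (x + a * u) * a) (at u)"
      by (rule DERIV_chain2[where f=\<Phi> and g="\<lambda>u. x + a * u"]) (rule \<Phi>[OF ne], auto intro!: derivative_eq_intros)
    have "(F has_real_derivative cos_bump r (x + a * u)) (at u)"
      unfolding F_def using assms
      by (auto intro!: derivative_eq_intros DERIV_cdivide[OF *, THEN DERIV_cong])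
    then show "(F has_vector_derivative cos_bump r (x + a * u)) (at u)"
      by (simp add: has_real_derivative_iff_has_vector_derivative)
  qed (use \<xi> assms in \<open>auto simp: F_def \<Phi>_def intro!: continuous_intros\<close>)
  then have int: "(\<integral>u. cos_bump r (x + a * u) \<partial>symmetric_uniform) = (F 1 - F (-1)) / 2"
    by (subst integral_symmetric_uniform)
       (auto intro!: continuous_intros continuous_on_compose2[OF continuous_cos_bump] simp: assms)
  \<comment> \<open>A primitive of the truncated minus the full cosine; what remains to be shown is
    \<open>H (x - a) \<le> H (x + a)\<close>.\<close>
  define H where "H z = \<Phi> z - sin (\<xi> * z) / \<xi>" for z
  have H0: "H z = 0" if "\<bar>z\<bar> \<le> r" for z
    using that by (auto simp: H_def \<Phi>_def max_def min_def)
  have Hpos: "0 \<le> H z" if "0 \<le> z" for z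
  proof (cases "z \<le> r")
    case False
    \<comment> \<open>Beyond \<open>r\<close> the clamped primitive stays at
      \<open>1 / \<xi>\<close>, the maximum of \<open>sin (\<xi> * z) / \<xi>\<close>.\<close>
    moreover have "sin (\<xi> * r) = 1" unfolding \<xi>(2) by simp
    ultimately show ?thesis
      using \<xi>(1) assms False by (simp add: H_def \<Phi>_def divide_right_mono)
  qed (use that H0[of z] in auto)
  have Hodd: "H (- z) = - H z" for z
    using assms by (cases "z = - r") (auto simp: H_def \<Phi>_def max_def min_def divide_simps)
  have "0 \<le> H (x + a) - H (x - a)"
  proof -
    consider "x - a > 0" | "x + a < 0" | "x - a \<le> 0" "0 \<le> x + a" by linarith
    then show ?thesis
    proof cases
      case 1
      \<comment> \<open>Since \<open>x \<le> r\<close> and \<open>0 < a\<close>, the point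
        \<open>x - a\<close> lies between 0 and \<open>r\<close>.\<close>
      then have "H (x - a) = 0" using x assms by (intro H0) auto
      then show ?thesis using Hpos[of "x + a"] 1 assms by simp
    next
      case 2
      then have "H (x + a) = 0" using x assms by (intro H0) auto
      then show ?thesis using Hpos[of "- (x - a)"] Hodd[of "x - a"] 2 assms by simp
    next
      case 3
      then show ?thesis using Hpos[of "- (x - a)"] Hpos[of "x + a"] Hodd[of "x - a"] by simp
    qed
  qed
  moreover have "sin (\<xi> * (x + a)) - sin (\<xi> * (x - a)) = 2 * (cos (\<xi> * x) * sin (\<xi> * a))"
    by (simp add: distrib_left right_diff_distrib sin_add sin_diff)
  then have "2 * (cos (\<xi> * x) * sin (\<xi> * a)) / \<xi> = sin (\<xi> * (x + a)) / \<xi> - sin (\<xi> * (x - a)) / \<xi>"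
    by (metis diff_divide_distrib)
  ultimately have "2 * (cos (\<xi> * x) * sin (\<xi> * a)) / \<xi> \<le> \<Phi> (x + a) - \<Phi> (x - a)"
    unfolding H_def by linarith
  then have "2 * (cos (\<xi> * x) * sin (\<xi> * a)) / \<xi> / a / 2 \<le> (\<Phi> (x + a) - \<Phi> (x - a)) / a / 2"
    using assms by (intro divide_right_mono) auto
  also have "\<dots> = (F 1 - F (-1)) / 2"
    by (simp add: F_def diff_divide_distrib)
  finally have "sin (\<xi> * a) / (\<xi> * a) * cos (\<xi> * x) \<le> (F 1 - F (-1)) / 2"
    by (simp add: mult_ac)
  moreover have "cos_bump r x = cos (\<xi> * x)" "sinc (pi / (2 * r) * a) = sin (\<xi> * a) / (\<xi> * a)"
    using x assms by (simp_all add: cos_bump_def \<xi>_def)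
  ultimately show ?thesis
    unfolding int by (simp only:)
qed

section \<open>Convolutions, weak limits and mixtures\<close>

lemma integral_convolution:
  fixes f :: "real \<Rightarrow> 'b::{banach,second_countable_topology}"
  assumes "real_distribution M" "real_distribution N"
    and [measurable]: "f \<in> borel_measurable borel" and bdd: "\<And>x. norm (f x) \<le> B"
  shows "integral\<^sup>L (convolution M N) f = (\<integral>x. \<integral>y. f (x + y) \<partial>N \<partial>M)"
proof -
  interpret M: real_distribution M by fact
  interpret N: real_distribution N by fact
  interpret pair_prob_space M N ..
  have "integrable (M \<Otimes>\<^sub>M N) (\<lambda>(x, y). f (x + y))"
    by (rule P.integrable_const_bound[where B=B]) (auto simp: bdd)
  from integral_fst'[OF this] show ?thesis
    unfolding convolution_def by (subst integral_distr) (auto simp: split_beta')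
qed

lemma real_distribution_convolution:
  assumes "real_distribution M" "real_distribution N"
  shows "real_distribution (convolution M N)"
proof -
  interpret M: real_distribution M by fact
  interpret N: real_distribution N by fact
  interpret pair_prob_space M N ..
  show ?thesis
    unfolding convolution_def by (rule real_distribution_distr) simp
qed

lemma char_convolution:
  assumes "real_distribution M" "real_distribution N"
  shows "char (convolution M N) t = char M t * char N t"
proof -
  have "char (convolution M N) t = (\<integral>x. \<integral>y. iexp (t * (x + y)) \<partial>N \<partial>M)"
    unfolding char_def by (rule integral_convolution[OF assms, where B=1]) auto
  also have "\<dots> = (\<integral>x. \<integral>y. iexp (t * x) * iexp (t * y) \<partial>N \<partial>M)"
    by (simp add: distrib_left exp_add)
  finally show ?thesis by (simp add: char_def)
qed

lemma (in prob_space) abs_expectation_le_1: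
  assumes "f \<in> borel_measurable M" "\<And>x. \<bar>f x\<bar> \<le> (1::real)"
  shows "\<bar>expectation f\<bar> \<le> 1"
proof -
  have "\<bar>expectation f\<bar> \<le> (\<integral>x. \<bar>f x\<bar> \<partial>M)"
    by (rule integral_abs_bound)
  also have "\<dots> \<le> (\<integral>x. 1 \<partial>M)"
    by (intro integral_mono integrable_const_bound[where B=1]) (use assms in auto)
  finally show ?thesis by (simp add: prob_space)
qed

primrec convolution_power :: "nat \<Rightarrow> real measure \<Rightarrow> real measure" where
  "convolution_power 0 M = return borel 0"
| "convolution_power (Suc n) M = convolution M (convolution_power n M)"

lemma real_distribution_return: "real_distribution (return borel x)"
  by (simp add: real_distribution_def real_distribution_axioms_def prob_space_return)

lemma real_distribution_convolution_power:
  "real_distribution M \<Longrightarrow> real_distribution (convolution_power n M)"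
  by (induction n) (auto simp: real_distribution_return real_distribution_convolution)

lemma char_convolution_power:
  assumes "real_distribution M"
  shows "char (convolution_power n M) t = char M t ^ n"
proof (induction n)
  case 0
  show ?case by (simp add: char_def integral_return)
qed (simp add: assms char_convolution real_distribution_convolution_power)

text \<open>Killing the walk with step law \<open>\<mu>\<close> outside \<open>[-r, r]\<close> does not make
  \<open>cos_bump r\<close> decay faster than the free walk makes the cosine decay.\<close>

definition cos_excessive :: "real \<Rightarrow> real measure \<Rightarrow> bool" where
  "cos_excessive r \<mu> \<longleftrightarrow>
     (\<exists>l\<ge>0. char \<mu> (pi / (2 * r)) = complex_of_real l \<and>
        (\<forall>x. l * cos_bump r x \<le> (\<integral>y. cos_bump r (x + y) \<partial>\<mu>)))"

lemma integrable_cos_bump: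
  assumes "real_distribution M" and [measurable]: "f \<in> borel_measurable borel"
  shows "integrable M (\<lambda>y. cos_bump r (f y))"
proof -
  interpret real_distribution M by fact
  show ?thesis
    by (rule integrable_const_bound[where B=1]) (auto simp: abs_cos_bump_le_1)
qed

text \<open>The bound for \<open>N\<close> is used at the point already shifted by the
  \<open>M\<close>-step, and the bound for \<open>M\<close> is scaled by \<open>k\<close>, which
  needs \<open>0 \<le> k\<close>. The factors multiply, as do the characteristic functions.\<close>

lemma cos_excessive_convolution:
  assumes M: "real_distribution M" "cos_excessive r M"
    and N: "real_distribution N" "cos_excessive r N"
  shows "cos_excessive r (convolution M N)"
proof -
  interpret N: real_distribution N by (rule N)
  interpret M: real_distribution M by (rule M)
  obtain l where l: "0 \<le> l" "char M (pi / (2 * r)) = complex_of_real l"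
    "\<And>x. l * cos_bump r x \<le> (\<integral>y. cos_bump r (x + y) \<partial>M)"
    using M(2) unfolding cos_excessive_def by blast
  obtain k where k: "0 \<le> k" "char N (pi / (2 * r)) = complex_of_real k"
    "\<And>x. k * cos_bump r x \<le> (\<integral>y. cos_bump r (x + y) \<partial>N)"
    using N(2) unfolding cos_excessive_def by blast
  have "l * k * cos_bump r x \<le> (\<integral>y. cos_bump r (x + y) \<partial>convolution M N)" for x
  proof -
    have "l * k * cos_bump r x \<le> k * (\<integral>y. cos_bump r (x + y) \<partial>M)"
      using mult_left_mono[OF l(3) k(1)] by (simp add: mult_ac)
    also have "\<dots> = (\<integral>y. k * cos_bump r (x + y) \<partial>M)" by simp
    also have "\<dots> \<le> (\<integral>y. (\<integral>z. cos_bump r (x + y + z) \<partial>N) \<partial>M)"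
    proof (rule integral_mono[OF _ _ k(3)])
      show "integrable M (\<lambda>y. k * cos_bump r (x + y))"
        by (intro integrable_mult_right integrable_cos_bump M(1)) simp
      have "norm (\<integral>z. cos_bump r (x + y + z) \<partial>N) \<le> 1" for y
        unfolding real_norm_def by (rule N.abs_expectation_le_1) (auto simp: abs_cos_bump_le_1)
      then show "integrable M (\<lambda>y. \<integral>z. cos_bump r (x + y + z) \<partial>N)"
        by (intro M.integrable_const_bound[where B=1]) auto
    qed
    also have "\<dots> = (\<integral>y. cos_bump r (x + y) \<partial>convolution M N)"
      by (subst integral_convolution[OF M(1) N(1), where B=1]) (auto simp: abs_cos_bump_le_1 add.assoc)
    finally show ?thesis .
  qed
  moreover have "char (convolution M N) (pi / (2 * r)) = complex_of_real (l * k)"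
    unfolding char_convolution[OF M(1) N(1)] l(2) k(2) by simp
  ultimately show ?thesis
    unfolding cos_excessive_def using l(1) k(1) by (intro exI[of _ "l * k"]) auto
qed

lemma cos_excessive_convolution_power:
  assumes "real_distribution M" "cos_excessive r M"
  shows "cos_excessive r (convolution_power n M)"
proof (induction n)
  case 0
  have eq: "(\<integral>y. cos_bump r (x + y) \<partial>return borel 0) = cos_bump r x" for x
    by (subst integral_return) auto
  show ?case
    unfolding cos_excessive_def char_convolution_power[OF assms(1)]
    by (intro exI[of _ 1]) (simp add: eq)
next
  case (Suc n)
  show ?case
    unfolding convolution_power.simps
    by (rule cos_excessive_convolution[OF assms real_distribution_convolution_power[OF assms(1)] Suc])
qed

text \<open>Levy's continuity theorem gives weak convergence, under which integrals of the bounded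
  continuous \<open>cos_bump r\<close> converge. The factors \<open>l n\<close> are values of
  characteristic functions and converge as well, so the inequality survives for each
  \<open>x\<close>.\<close>

lemma cos_excessive_weak_limit:
  assumes r: "0 < r"
    and M: "\<And>n. real_distribution (M n)" "\<And>n. cos_excessive r (M n)"
    and M': "real_distribution M'"
    and lim: "\<And>t. (\<lambda>n. char (M n) t) \<longlonglongrightarrow> char M' t"
  shows "cos_excessive r M'"
proof -
  have weak: "weak_conv_m M M'"
    by (rule levy_continuity[OF M(1) M' lim])
  obtain l where l: "\<And>n. 0 \<le> l n" "\<And>n. char (M n) (pi / (2 * r)) = complex_of_real (l n)"
    "\<And>n x. l n * cos_bump r x \<le> (\<integral>y. cos_bump r (x + y) \<partial>M n)"
    using M(2) unfolding cos_excessive_def by metis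
  \<comment> \<open>The limit of the real factors \<open>l n\<close>; the imaginary part of the
    limiting characteristic function is shown to vanish below.\<close>
  define l' where "l' = Re (char M' (pi / (2 * r)))"
  have lim_l: "(\<lambda>n. complex_of_real (l n)) \<longlonglongrightarrow> char M' (pi / (2 * r))"
    using lim[of "pi / (2 * r)"] by (simp add: l(2))
  have "l \<longlonglongrightarrow> l'"
    using tendsto_Re[OF lim_l] by (simp add: l'_def)
  moreover have "char M' (pi / (2 * r)) = complex_of_real l'"
  proof -
    have "Im (char M' (pi / (2 * r))) = 0"
      using LIMSEQ_unique[OF tendsto_Im[OF lim_l], of 0] by simp
    then show ?thesis unfolding l'_def by (simp add: complex_eq_iff)
  qed
  moreover have "0 \<le> l'"
    using \<open>l \<longlonglongrightarrow> l'\<close> l(1) by (rule LIMSEQ_le_const[OF _ exI, rule_format])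
  moreover have "l' * cos_bump r x \<le> (\<integral>y. cos_bump r (x + y) \<partial>M')" for x
  proof (rule LIMSEQ_le)
    show "(\<lambda>n. l n * cos_bump r x) \<longlonglongrightarrow> l' * cos_bump r x"
      by (intro tendsto_intros \<open>l \<longlonglongrightarrow> l'\<close>)
    have "isCont (\<lambda>y. cos_bump r (x + y)) y" for y
      by (rule isCont_o2[where g="cos_bump r"])
         (use continuous_cos_bump[OF r, of UNIV] in \<open>simp_all add: continuous_on_eq_continuous_at\<close>)
    then show "(\<lambda>n. \<integral>y. cos_bump r (x + y) \<partial>M n) \<longlonglongrightarrow> (\<integral>y. cos_bump r (x + y) \<partial>M')"
      by (intro weak_conv_imp_integral_bdd_continuous_conv[OF M(1) M' weak, where B=1])
         (auto simp: abs_cos_bump_le_1)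
    show "\<exists>N. \<forall>n\<ge>N. l n * cos_bump r x \<le> (\<integral>y. cos_bump r (x + y) \<partial>M n)"
      by (intro exI allI impI l(3))
  qed
  ultimately show ?thesis
    unfolding cos_excessive_def by blast
qed

text \<open>The law of a product of independent variables, one distributed as \<open>P\<close> and
  one uniform on \<open>[-1, 1]\<close>: Khintchine's form of a symmetric unimodal law.\<close>

definition uniform_mixture :: "real measure \<Rightarrow> real measure" where
  "uniform_mixture P = distr (P \<Otimes>\<^sub>M symmetric_uniform) borel (\<lambda>(w, u). w * u)"

lemma integral_uniform_mixture:
  fixes f :: "real \<Rightarrow> 'b::{banach,second_countable_topology}"
  assumes "real_distribution P"
    and [measurable]: "f \<in> borel_measurable borel" and bdd: "\<And>x. norm (f x) \<le> B"
  shows "integral\<^sup>L (uniform_mixture P) f = (\<integral>w. \<integral>u. f (w * u) \<partial>symmetric_uniform \<partial>P)"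
proof -
  interpret P: real_distribution P by fact
  interpret PU: pair_prob_space P symmetric_uniform ..
  have "integrable (P \<Otimes>\<^sub>M symmetric_uniform) (\<lambda>(x, y). f (x * y))"
    by (rule PU.P.integrable_const_bound[where B=B]) (auto simp: bdd)
  from PU.integral_fst'[OF this] show ?thesis
    unfolding uniform_mixture_def by (subst integral_distr) (auto simp: split_beta')
qed

lemma real_distribution_uniform_mixture:
  assumes "real_distribution P"
  shows "real_distribution (uniform_mixture P)"
proof -
  interpret P: real_distribution P by fact
  interpret PU: pair_prob_space P symmetric_uniform ..
  show ?thesis
    unfolding uniform_mixture_def by (rule PU.P.real_distribution_distr) simp
qed

lemma char_uniform_mixture:
  assumes "real_distribution P"
  shows "char (uniform_mixture P) t = complex_of_real (\<integral>w. sinc (t * w) \<partial>P)"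
proof -
  have "char (uniform_mixture P) t = (\<integral>w. \<integral>u. iexp (t * (w * u)) \<partial>symmetric_uniform \<partial>P)"
    unfolding char_def by (rule integral_uniform_mixture[OF assms, where B=1]) auto
  also have "\<dots> = (\<integral>w. complex_of_real (sinc (t * w)) \<partial>P)"
    by (simp only: mult.assoc[symmetric] integral_uniform_iexp)
  finally show ?thesis
    by (simp only: integral_complex_of_real)
qed

lemma abs_sinc_le_1: "\<bar>sinc x\<bar> \<le> 1"
  using abs_sin_x_le_abs_x[of x] by (simp add: divide_le_eq_1)

text \<open>\<open>uniform_cos_bump_ge\<close> is integrated over the width \<open>w\<close>. Since
  \<open>sinc\<close> also takes negative values, the sign of the averaged factor enters as a
  hypothesis.\<close>

lemma cos_excessive_uniform_mixture:
  assumes r: "0 < r" and P: "real_distribution P" and pos: "AE w in P. 0 < w"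
    and nonneg: "0 \<le> (\<integral>w. sinc (pi / (2 * r) * w) \<partial>P)"
  shows "cos_excessive r (uniform_mixture P)"
proof -
  interpret P: real_distribution P by fact
  have "(\<integral>w. sinc (pi / (2 * r) * w) \<partial>P) * cos_bump r x
      \<le> (\<integral>y. cos_bump r (x + y) \<partial>uniform_mixture P)" for x
  proof -
    have "(\<integral>w. sinc (pi / (2 * r) * w) \<partial>P) * cos_bump r x
        = (\<integral>w. sinc (pi / (2 * r) * w) * cos_bump r x \<partial>P)"
      by (simp only: integral_mult_left_zero)
    also have "\<dots> \<le> (\<integral>w. \<integral>u. cos_bump r (x + w * u) \<partial>symmetric_uniform \<partial>P)"
    proof (rule integral_mono_AE)
      have "\<bar>sinc (pi / (2 * r) * w) * cos_bump r x\<bar> \<le> 1" for w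
        unfolding abs_mult by (intro mult_le_one abs_cos_bump_le_1 abs_sinc_le_1 abs_ge_zero)
      then show "integrable P (\<lambda>w. sinc (pi / (2 * r) * w) * cos_bump r x)"
        unfolding real_norm_def[symmetric]
        by (intro P.integrable_const_bound[where B=1] always_eventually allI) auto
      have "norm (\<integral>u. cos_bump r (x + w * u) \<partial>symmetric_uniform) \<le> 1" for w
        unfolding real_norm_def by (rule symmetric_uniform.abs_expectation_le_1) (auto simp: abs_cos_bump_le_1)
      then show "integrable P (\<lambda>w. \<integral>u. cos_bump r (x + w * u) \<partial>symmetric_uniform)"
        by (intro P.integrable_const_bound[where B=1]) auto
      show "AE w in P. sinc (pi / (2 * r) * w) * cos_bump r x
          \<le> (\<integral>u. cos_bump r (x + w * u) \<partial>symmetric_uniform)"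
        using pos by eventually_elim (rule uniform_cos_bump_ge[OF r])
    qed
    also have "\<dots> = (\<integral>y. cos_bump r (x + y) \<partial>uniform_mixture P)"
      by (subst integral_uniform_mixture[OF P, where B=1]) (auto simp: abs_cos_bump_le_1)
    finally show ?thesis .
  qed
  then show ?thesis
    unfolding cos_excessive_def using nonneg
    by (intro exI[of _ "\<integral>w. sinc (pi / (2 * r) * w) \<partial>P"] conjI char_uniform_mixture[OF P] allI) assumption+
qed

section \<open>Symmetric stable laws\<close>

text \<open>The tail beyond \<open>w \<ge> s\<close> is \<open>(s / w) powr \<alpha>\<close>, so
  sums of such variables, given random signs, fall in the domain of attraction of the stable law
  when \<open>\<alpha> < 2\<close>.\<close>

definition pareto :: "real \<Rightarrow> real \<Rightarrow> real measure" where
  "pareto \<alpha> s = density lborel (\<lambda>w. ennreal (indicator {s..} w * (\<alpha> * s powr \<alpha> * w powr (- \<alpha> - 1))))"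

lemma real_distribution_pareto:
  assumes "0 < \<alpha>" "0 < s"
  shows "real_distribution (pareto \<alpha> s)"
proof -
  have "((\<lambda>w. \<alpha> * s powr \<alpha> * w powr (- \<alpha> - 1)) has_integral
      \<alpha> * s powr \<alpha> * (- (s powr (- \<alpha> - 1 + 1)) / (- \<alpha> - 1 + 1))) {s..}"
    using assms by (intro has_integral_mult_right has_integral_powr_to_inf) auto
  also have "\<alpha> * s powr \<alpha> * (- (s powr (- \<alpha> - 1 + 1)) / (- \<alpha> - 1 + 1)) = 1"
    using assms by (simp add: powr_minus field_simps)
  finally have "((\<lambda>w. indicator {s..} w * (\<alpha> * s powr \<alpha> * w powr (- \<alpha> - 1))) has_integral 1) UNIV"
    by (subst (asm) has_integral_restrict_UNIV[symmetric]) (simp add: indicator_def of_bool_def if_distrib if_distribR cong: if_cong)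
  then have "(\<integral>\<^sup>+w. ennreal (indicator {s..} w * (\<alpha> * s powr \<alpha> * w powr (- \<alpha> - 1))) \<partial>lborel) = ennreal 1"
    using assms by (intro nn_integral_has_integral_lborel) auto
  then have "emeasure (pareto \<alpha> s) (space (pareto \<alpha> s)) = 1"
    by (simp add: pareto_def emeasure_density)
  then have "prob_space (pareto \<alpha> s)"
    by (rule prob_spaceI)
  then show ?thesis
    by (simp add: real_distribution_def real_distribution_axioms_def pareto_def)
qed

lemma AE_pareto_pos:
  assumes "0 < s"
  shows "AE w in pareto \<alpha> s. 0 < w"
  unfolding pareto_def using assms by (subst AE_density) (auto simp: indicator_def)

lemma integral_pareto:
  fixes f :: "real \<Rightarrow> real"
  assumes "0 < \<alpha>" and [measurable]: "f \<in> borel_measurable borel"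
  shows "(\<integral>w. f w \<partial>pareto \<alpha> s)
    = \<alpha> * s powr \<alpha> * (\<integral>w. indicator {s..} w * (w powr (- \<alpha> - 1) * f w) \<partial>lborel)"
  unfolding pareto_def using assms
  by (subst integral_density) (auto simp: mult_ac simp flip: integral_mult_right_zero)

lemma one_minus_sinc_nonneg: "0 \<le> 1 - sinc x"
  using abs_sinc_le_1[of x] by linarith

lemma one_minus_sinc_le_2: "1 - sinc x \<le> 2"
  using abs_sinc_le_1[of x] by linarith

text \<open>From the cubic remainder
  \<open>\<bar>sin x - x\<bar> \<le> \<bar>x\<bar> ^ 3 / 6\<close>, with the constant rounded up to
  1. It controls \<open>stable_integrand\<close> near 0.\<close>

lemma one_minus_sinc_le_square: "1 - sinc x \<le> x\<^sup>2"
proof (cases "x = 0")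
  case False
  have "\<bar>sin x - x\<bar> \<le> inverse (fact 3) * \<bar>x\<bar> ^ 3"
    using Maclaurin_sin_bound[of x 3] by (simp add: numeral_3_eq_3 sin_coeff_def)
  also have "\<dots> \<le> 1 * \<bar>x\<bar> ^ 3"
    by (intro mult_right_mono) (auto simp: fact_numeral)
  finally have "\<bar>sin x - x\<bar> / \<bar>x\<bar> \<le> \<bar>x\<bar> ^ 3 / \<bar>x\<bar>"
    by (intro divide_right_mono) auto
  also have "\<bar>x\<bar> ^ 3 / \<bar>x\<bar> = x\<^sup>2"
    using False by (simp add: power3_eq_cube power2_eq_square)
  also have "\<bar>sin x - x\<bar> / \<bar>x\<bar> = \<bar>sinc x - 1\<bar>"
    using False by (simp add: diff_divide_distrib flip: abs_divide)
  finally show ?thesis by linarith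
qed simp

text \<open>\<open>1 - sinc (t w)\<close> integrated against the infinite measure to which the rescaled Pareto laws
  converge.\<close>

definition stable_integrand :: "real \<Rightarrow> real \<Rightarrow> real \<Rightarrow> real" where
  "stable_integrand \<alpha> t w = indicator {0<..} w * (w powr (- \<alpha> - 1) * (1 - sinc (t * w)))"

lemma borel_measurable_stable_integrand [measurable]: "stable_integrand \<alpha> t \<in> borel_measurable borel"
proof -
  have [measurable]: "(\<lambda>w. sinc (t * w)) \<in> borel_measurable borel"
    by (rule measurable_compose[OF _ borel_measurable_sinc]) measurable
  show ?thesis unfolding stable_integrand_def[abs_def] by measurable
qed

lemma stable_integrand_nonneg: "0 \<le> stable_integrand \<alpha> t w"
  unfolding stable_integrand_def by (intro mult_nonneg_nonneg one_minus_sinc_nonneg) auto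

text \<open>The quadratic bound leaves \<open>w powr (1 - \<alpha>)\<close> on
  \<open>[0, 1]\<close>, integrable because \<open>\<alpha> < 2\<close>; the bound by 2 leaves
  \<open>w powr (- \<alpha> - 1)\<close> on \<open>[1, \<infinity>)\<close>, integrable because
  \<open>0 < \<alpha>\<close>.\<close>

lemma integrable_stable_integrand:
  assumes "0 < \<alpha>" "\<alpha> < 2"
  shows "integrable lborel (stable_integrand \<alpha> t)"
proof (rule Bochner_Integration.integrable_bound)
  have "set_integrable lborel {0..1} (\<lambda>w::real. w powr (1 - \<alpha>))"
  proof -
    have "(\<lambda>w::real. w powr (1 - \<alpha>)) absolutely_integrable_on {0..1}"
      using assms by (intro nonnegative_absolutely_integrable_1 integrable_on_powr_from_0) auto
    then show ?thesis
      unfolding set_integrable_def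
      by (subst (asm) integrable_completion) auto
  qed
  moreover have "set_integrable lborel {1..} (\<lambda>w::real. w powr (- \<alpha> - 1))"
  proof -
    have "(\<lambda>w::real. w powr (- \<alpha> - 1)) absolutely_integrable_on {1..}"
      using assms has_integral_powr_to_inf[of "- \<alpha> - 1" 1]
      by (intro nonnegative_absolutely_integrable_1) (auto simp: integrable_on_def)
    then show ?thesis
      unfolding set_integrable_def
      by (subst (asm) integrable_completion) auto
  qed
  ultimately show "integrable lborel (\<lambda>w. t\<^sup>2 * (indicator {0..1} w * w powr (1 - \<alpha>))
      + 2 * (indicator {1..} w * w powr (- \<alpha> - 1)))"
    unfolding set_integrable_def by (intro Bochner_Integration.integrable_add integrable_mult_right) auto
  show "AE w in lborel. norm (stable_integrand \<alpha> t w) \<le>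
      norm (t\<^sup>2 * (indicator {0..1} w * w powr (1 - \<alpha>)) + 2 * (indicator {1..} w * w powr (- \<alpha> - 1)))"
  proof (intro always_eventually allI)
    fix w :: real
    let ?b = "t\<^sup>2 * (indicator {0..1} w * w powr (1 - \<alpha>)) + 2 * (indicator {1..} w * w powr (- \<alpha> - 1))"
    have b: "0 \<le> ?b" by simp
    have eq: "stable_integrand \<alpha> t w = w powr (- \<alpha> - 1) * (1 - sinc (t * w))" if "0 < w"
      using that by (simp add: stable_integrand_def)
    have "stable_integrand \<alpha> t w \<le> ?b"
    proof -
      consider "w \<le> 0" | "0 < w" "w \<le> 1" | "1 < w" by linarith
      then show ?thesis
      proof cases
        case 1
        then show ?thesis using b by (simp add: stable_integrand_def)
      next
        case 2
        have "stable_integrand \<alpha> t w \<le> w powr (- \<alpha> - 1) * (t * w)\<^sup>2"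
          unfolding eq[OF 2(1)] by (intro mult_left_mono one_minus_sinc_le_square) simp
        also have "(t * w)\<^sup>2 = t\<^sup>2 * w powr 2" using 2 by (simp add: power_mult_distrib powr_numeral)
        also have "w powr (- \<alpha> - 1) * (t\<^sup>2 * w powr 2) = t\<^sup>2 * w powr (1 - \<alpha>)"
          by (simp add: mult_ac flip: powr_add)
        also have "\<dots> \<le> ?b" using 2 by simp
        finally show ?thesis .
      next
        case 3
        have "stable_integrand \<alpha> t w \<le> w powr (- \<alpha> - 1) * 2"
          using 3 by (subst eq) (simp, intro mult_left_mono one_minus_sinc_le_2, simp)
        then show ?thesis using 3 by simp
      qed
    qed
    then show "norm (stable_integrand \<alpha> t w) \<le> norm ?b"
      using stable_integrand_nonneg[of \<alpha> t w] by simp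
  qed
qed simp

definition stable_integral :: "real \<Rightarrow> real \<Rightarrow> real" where
  "stable_integral \<alpha> t = (\<integral>w. stable_integrand \<alpha> t w \<partial>lborel)"

text \<open>For \<open>t \<noteq> 0\<close>, substitute \<open>\<bar>t\<bar> * w\<close> for
  \<open>w\<close> and use that \<open>sinc\<close> is even. Thus the value at 1 stays an
  unevaluated constant, to be normalised away.\<close>

lemma stable_integral_scale:
  assumes "0 < \<alpha>"
  shows "stable_integral \<alpha> t = \<bar>t\<bar> powr \<alpha> * stable_integral \<alpha> 1"
proof (cases "t = 0")
  case True
  then show ?thesis using assms by (simp add: stable_integral_def stable_integrand_def)
next
  case False
  have eq: "stable_integrand \<alpha> 1 (0 + \<bar>t\<bar> * w) = \<bar>t\<bar> powr (- \<alpha> - 1) * stable_integrand \<alpha> t w" for w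
  proof -
    have "sinc (\<bar>t\<bar> * w) = sinc (t * w)" by (auto simp: abs_if)
    then show ?thesis
      unfolding stable_integrand_def using False
      by (cases "0 < w") (simp_all add: powr_mult zero_less_mult_iff del: mult_eq_0_iff)
  qed
  have "stable_integral \<alpha> 1 = \<bar>t\<bar> * (\<bar>t\<bar> powr (- \<alpha> - 1) * stable_integral \<alpha> t)"
    unfolding stable_integral_def using False
    by (subst lborel_integral_real_affine[where c="\<bar>t\<bar>" and t=0]) (simp_all only: eq integral_mult_right_zero, auto)
  also have "\<dots> = \<bar>t\<bar> powr (- \<alpha>) * stable_integral \<alpha> t"
    using False by (simp add: powr_diff)
  finally show ?thesis
    using False by (simp add: powr_minus)
qed

text \<open>On \<open>[2, 3]\<close> one has \<open>sinc w \<le> 1 / 2\<close>, which already gives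
  positive mass. The constant is later a denominator.\<close>

lemma stable_integral_pos:
  assumes "0 < \<alpha>" "\<alpha> < 2"
  shows "0 < stable_integral \<alpha> 1"
proof -
  have "(\<integral>w. indicator {2..3::real} w * (3 powr (- \<alpha> - 1) * (1 / 2)) \<partial>lborel) \<le> stable_integral \<alpha> 1"
    unfolding stable_integral_def
  proof (rule integral_mono)
    fix w :: real
    show "indicator {2..3} w * (3 powr (- \<alpha> - 1) * (1 / 2)) \<le> stable_integrand \<alpha> 1 w"
    proof (cases "w \<in> {2..3}")
      case True
      have "sin w / w \<le> 1 / 2"
        using True by (intro frac_le) auto
      then have "3 powr (- \<alpha> - 1) * (1 / 2) \<le> w powr (- \<alpha> - 1) * (1 - sin w / w)"
        using True assms by (intro mult_mono powr_mono2') auto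
      then show ?thesis using True by (simp add: stable_integrand_def)
    qed (simp add: stable_integrand_nonneg)
  qed (auto intro!: integrable_stable_integrand assms)
  moreover have "(\<integral>w. indicator {2..3::real} w * (3 powr (- \<alpha> - 1) * (1 / 2)) \<partial>lborel) > (0::real)"
    by simp
  ultimately show ?thesis by linarith
qed

text \<open>The law is the weak limit of sums of \<open>Suc n\<close> independent Pareto mixtures of
  uniform laws with minimal width \<open>s n\<close>. The characteristic function of one summand is
  \<open>1 - a n t / Suc n\<close> with \<open>a n t\<close> tending to
  \<open>c * \<bar>t\<bar> powr \<alpha>\<close>, so its power of exponent \<open>Suc n\<close>
  tends to the stable exponential.\<close>

lemma stable_cos_excessive:
  assumes \<alpha>: "0 < \<alpha>" "\<alpha> < 2" and r: "0 < r" and c: "0 < c"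
    and \<mu>: "real_distribution \<mu>"
    and char: "\<And>t. char \<mu> t = complex_of_real (exp (- c * \<bar>t\<bar> powr \<alpha>))"
  shows "cos_excessive r \<mu>"
proof -
  \<comment> \<open>Normalised so that \<open>A * \<alpha> * stable_integral \<alpha> t = c *
    \<bar>t\<bar> powr \<alpha>\<close>.\<close>
  define A where "A = c / (\<alpha> * stable_integral \<alpha> 1)"
  have A: "0 < A" using \<alpha> c stable_integral_pos[OF \<alpha>] by (simp add: A_def)
  \<comment> \<open>Chosen so that the Pareto prefactor \<open>\<alpha> * s n powr \<alpha>\<close>
    equals \<open>\<alpha> * A / Suc n\<close>, matching a sum of \<open>Suc n\<close>
    terms.\<close>
  define s where "s n = (A / Suc n) powr (1 / \<alpha>)" for n :: nat
  have s: "0 < s n" "s n powr \<alpha> = A / Suc n" for n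
    using A \<alpha> by (simp_all add: s_def powr_powr)
  have "(\<lambda>n. A / Suc n) \<longlonglongrightarrow> 0"
    by real_asymp
  then have s_lim: "s \<longlonglongrightarrow> 0"
    unfolding s_def[abs_def] using \<alpha> A by (intro tendsto_zero_powrI[where b="1/\<alpha>"]) auto
  note dist = real_distribution_pareto[OF \<alpha>(1) s(1)]
  define l where "l n t = (\<integral>w. sinc (t * w) \<partial>pareto \<alpha> (s n))" for n t
  define a where "a n t = A * \<alpha> * (\<integral>w. indicator {s n..} w * stable_integrand \<alpha> t w \<partial>lborel)" for n t
  have l_eq: "l n t = 1 - a n t / Suc n" for n t
  proof -
    interpret P: real_distribution "pareto \<alpha> (s n)" by (rule dist)
    have [measurable]: "(\<lambda>w. sinc (t * w)) \<in> borel_measurable borel"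
      by (rule measurable_compose[OF _ borel_measurable_sinc]) measurable
    have "integrable (pareto \<alpha> (s n)) (\<lambda>w. sinc (t * w))"
      by (intro P.integrable_const_bound[where B=1] always_eventually allI)
         (simp_all only: real_norm_def abs_sinc_le_1, measurable)
    then have "1 - l n t = (\<integral>w. 1 - sinc (t * w) \<partial>pareto \<alpha> (s n))"
      unfolding l_def by (subst Bochner_Integration.integral_diff) (simp_all add: P.prob_space[simplified])
    also have "\<dots> = \<alpha> * s n powr \<alpha> * (\<integral>w. indicator {s n..} w * (w powr (- \<alpha> - 1) * (1 - sinc (t * w))) \<partial>lborel)"
      by (rule integral_pareto[OF \<alpha>(1)]) measurable
    also have "(\<integral>w. indicator {s n..} w * (w powr (- \<alpha> - 1) * (1 - sinc (t * w))) \<partial>lborel)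
        = (\<integral>w. indicator {s n..} w * stable_integrand \<alpha> t w \<partial>lborel)"
      using s(1)[of n] by (intro Bochner_Integration.integral_cong) (auto simp: stable_integrand_def indicator_def)
    finally have "1 - l n t = a n t / Suc n"
      unfolding a_def s(2) by (simp add: mult_ac)
    then show ?thesis by linarith
  qed
  have a_lim: "(\<lambda>n. a n t) \<longlonglongrightarrow> c * \<bar>t\<bar> powr \<alpha>" for t
  proof -
    have "(\<lambda>n. \<integral>w. indicator {s n..} w * stable_integrand \<alpha> t w \<partial>lborel) \<longlonglongrightarrow> stable_integral \<alpha> t"
      unfolding stable_integral_def
    \<comment> \<open>As \<open>s n\<close> tends to 0, the cut-off eventually lies below any fixed
      \<open>w > 0\<close>; the full integrand dominates.\<close>
    proof (rule integral_dominated_convergence[where w="stable_integrand \<alpha> t"])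
      show "AE w in lborel. (\<lambda>n. indicator {s n..} w * stable_integrand \<alpha> t w) \<longlonglongrightarrow> stable_integrand \<alpha> t w"
      proof (intro always_eventually allI)
        fix w :: real
        show "(\<lambda>n. indicator {s n..} w * stable_integrand \<alpha> t w) \<longlonglongrightarrow> stable_integrand \<alpha> t w"
        proof (cases "0 < w")
          case True
          then have "\<forall>\<^sub>F n in sequentially. s n < w"
            using s_lim by (simp add: order_tendsto_iff)
          then show ?thesis
            by (intro tendsto_eventually) (erule eventually_mono, simp)
        qed (simp add: stable_integrand_def)
      qed
      show "AE w in lborel. norm (indicator {s n..} w * stable_integrand \<alpha> t w) \<le> stable_integrand \<alpha> t w" for n
        by (intro always_eventually allI) (auto simp: indicator_def stable_integrand_nonneg)
    qed (auto intro!: integrable_stable_integrand \<alpha>)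
    then have "(\<lambda>n. a n t) \<longlonglongrightarrow> A * \<alpha> * stable_integral \<alpha> t"
      unfolding a_def by (intro tendsto_intros)
    also have "A * \<alpha> * stable_integral \<alpha> t = c * \<bar>t\<bar> powr \<alpha>"
      using \<alpha> stable_integral_pos[OF \<alpha>] stable_integral_scale[OF \<alpha>(1), of t] by (simp add: A_def)
    finally show ?thesis .
  qed
  have l_lim: "(\<lambda>n. l n t) \<longlonglongrightarrow> 1" for t
  proof -
    have "(\<lambda>n. 1 - a n t * inverse (real (Suc n))) \<longlonglongrightarrow> 1 - c * \<bar>t\<bar> powr \<alpha> * 0"
      by (intro tendsto_intros a_lim LIMSEQ_inverse_real_of_nat)
    then show ?thesis by (simp add: l_eq divide_inverse)
  qed
  define \<nu> where "\<nu> n = convolution_power (Suc n) (uniform_mixture (pareto \<alpha> (s n)))" for n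
  have \<nu>: "real_distribution (\<nu> n)" for n
    unfolding \<nu>_def by (intro real_distribution_convolution_power real_distribution_uniform_mixture dist)
  have char_\<nu>: "char (\<nu> n) t = complex_of_real (l n t ^ Suc n)" for n t
    unfolding \<nu>_def char_convolution_power[OF real_distribution_uniform_mixture[OF dist]]
    by (simp only: char_uniform_mixture[OF dist] l_def of_real_power)
  have lim: "(\<lambda>n. char (\<nu> n) t) \<longlonglongrightarrow> char \<mu> t" for t
  proof -
    define b where "b = c * \<bar>t\<bar> powr \<alpha>"
    have abs_l: "\<bar>l n t\<bar> \<le> 1" for n
    proof -
      interpret P: real_distribution "pareto \<alpha> (s n)" by (rule dist)
      have "(\<lambda>w. sinc (t * w)) \<in> borel_measurable borel"
        by (rule measurable_compose[OF _ borel_measurable_sinc]) measurable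
      then show ?thesis
        unfolding l_def by (intro P.abs_expectation_le_1 abs_sinc_le_1) simp
    qed
    have exp_lim: "(\<lambda>n. (1 + (- b) / real (Suc n)) ^ Suc n) \<longlonglongrightarrow> exp (- b)"
      by (rule LIMSEQ_Suc[OF tendsto_exp_limit_sequentially])
    \<comment> \<open>For numbers of modulus at most 1, powers of exponent \<open>m\<close> differ
      by at most \<open>m\<close> times the difference of the bases. Here that product is
      \<open>\<bar>b - a n t\<bar>\<close>, which tends to 0.\<close>
    have "(\<lambda>n. l n t ^ Suc n - (1 + (- b) / real (Suc n)) ^ Suc n) \<longlonglongrightarrow> 0"
    proof (rule Lim_null_comparison)
      have "\<forall>\<^sub>F n in sequentially. \<bar>1 + (- b) / real (Suc n)\<bar> \<le> 1"
      proof -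
        have "\<forall>\<^sub>F n in sequentially. b \<le> real (Suc n)" by real_asymp
        then show ?thesis
          by (rule eventually_mono) (use c in \<open>simp add: abs_le_iff field_simps b_def\<close>)
      qed
      then show "\<forall>\<^sub>F n in sequentially. norm (l n t ^ Suc n - (1 + (- b) / real (Suc n)) ^ Suc n) \<le> \<bar>b - a n t\<bar>"
      proof (rule eventually_mono)
        fix n assume "\<bar>1 + (- b) / real (Suc n)\<bar> \<le> 1"
        then have "norm (l n t ^ Suc n - (1 + (- b) / real (Suc n)) ^ Suc n)
            \<le> real (Suc n) * norm (l n t - (1 + (- b) / real (Suc n)))"
          using abs_l by (intro norm_power_diff) auto
        also have "\<dots> = \<bar>real (Suc n) * (l n t - (1 + (- b) / real (Suc n)))\<bar>"
          by (simp only: abs_mult real_norm_def abs_of_nat)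
        also have "real (Suc n) * (l n t - (1 + (- b) / real (Suc n))) = b - a n t"
        proof -
          have "l n t - (1 + (- b) / real (Suc n)) = (b - a n t) / real (Suc n)"
            unfolding l_eq by (simp only: diff_divide_distrib minus_divide_left[symmetric])
          then show ?thesis by simp
        qed
        finally show "norm (l n t ^ Suc n - (1 + (- b) / real (Suc n)) ^ Suc n) \<le> \<bar>b - a n t\<bar>" .
      qed
      show "(\<lambda>n. \<bar>b - a n t\<bar>) \<longlonglongrightarrow> 0"
        using tendsto_rabs[OF tendsto_diff[OF tendsto_const a_lim[of t]], of b] by (simp add: b_def)
    qed
    from tendsto_add[OF this exp_lim] have "(\<lambda>n. l n t ^ Suc n) \<longlonglongrightarrow> exp (- b)"
      by simp
    then show ?thesis
      unfolding char_\<nu> char by (intro tendsto_of_real) (simp add: b_def)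
  qed
  \<comment> \<open>The summands are known to be excessive only when this factor is nonnegative,
    which holds from some \<open>N\<close> on because \<open>l n\<close> tends to 1; the sequence is
    therefore started at \<open>N\<close>.\<close>
  have "\<forall>\<^sub>F n in sequentially. 0 < l n (pi / (2 * r))"
    using l_lim[of "pi / (2 * r)"] by (simp add: order_tendsto_iff)
  then obtain N where N: "\<And>n. 0 < l (n + N) (pi / (2 * r))"
    by (metis eventually_sequentially le_add2)
  show ?thesis
  proof (rule cos_excessive_weak_limit[OF r \<nu> _ \<mu>])
    show "cos_excessive r (\<nu> (n + N))" for n
      unfolding \<nu>_def using N[of n] unfolding l_def
      by (intro cos_excessive_convolution_power real_distribution_uniform_mixture
          cos_excessive_uniform_mixture r dist AE_pareto_pos s less_imp_le)
    show "(\<lambda>n. char (\<nu> (n + N)) t) \<longlonglongrightarrow> char \<mu> t" for t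
      by (rule LIMSEQ_ignore_initial_segment[OF lim])
  qed
qed

section \<open>Random walks confined to an interval\<close>

text \<open>The joint law of independent variables is a product, so by Fubini \<open>V\<close> may
  be integrated out with \<open>U\<close> frozen.\<close>

lemma (in prob_space) indep_var_expectation:
  fixes f :: "'b \<times> 'b \<Rightarrow> real"
  assumes ind: "indep_var S U T V" and f[measurable]: "f \<in> borel_measurable (S \<Otimes>\<^sub>M T)"
    and bdd: "\<And>x. \<bar>f x\<bar> \<le> 1"
  shows "expectation (\<lambda>\<omega>. f (U \<omega>, V \<omega>)) = expectation (\<lambda>\<omega>. expectation (\<lambda>\<omega>'. f (U \<omega>, V \<omega>')))"
proof -
  have [measurable]: "U \<in> measurable M S" "V \<in> measurable M T"
    using ind by (auto dest: indep_var_rv1 indep_var_rv2)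
  interpret U: prob_space "distr M S U" by (rule prob_space_distr) simp
  interpret V: prob_space "distr M T V" by (rule prob_space_distr) simp
  interpret UV: pair_prob_space "distr M S U" "distr M T V" ..
  have "expectation (\<lambda>\<omega>. f (U \<omega>, V \<omega>)) = integral\<^sup>L (distr M (S \<Otimes>\<^sub>M T) (\<lambda>\<omega>. (U \<omega>, V \<omega>))) f"
    by (subst integral_distr) auto
  also have "distr M (S \<Otimes>\<^sub>M T) (\<lambda>\<omega>. (U \<omega>, V \<omega>)) = distr M S U \<Otimes>\<^sub>M distr M T V"
    using ind by (simp add: indep_var_distribution_eq)
  also have "integral\<^sup>L (distr M S U \<Otimes>\<^sub>M distr M T V) f
      = (\<integral>x. \<integral>y. f (x, y) \<partial>distr M T V \<partial>distr M S U)"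
    by (rule UV.integral_fst'[symmetric], rule UV.P.integrable_const_bound[where B=1]) (auto simp: bdd)
  also have "\<dots> = expectation (\<lambda>\<omega>. \<integral>y. f (U \<omega>, y) \<partial>distr M T V)"
    by (rule integral_distr) (auto intro!: V.borel_measurable_lebesgue_integral)
  also have "\<dots> = expectation (\<lambda>\<omega>. expectation (\<lambda>\<omega>'. f (U \<omega>, V \<omega>')))"
  proof (rule Bochner_Integration.integral_cong[OF refl])
    fix \<omega> assume \<omega>: "\<omega> \<in> space M"
    then have "U \<omega> \<in> space S" by (rule measurable_space[rotated]) simp
    then show "(\<integral>y. f (U \<omega>, y) \<partial>distr M T V) = expectation (\<lambda>\<omega>'. f (U \<omega>, V \<omega>'))"
      by (intro integral_distr) measurable
  qed
  finally show ?thesis .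
qed

text \<open>Let \<open>e k\<close> be the expectation of \<open>cos_bump r\<close> at the walk's
  position at time \<open>k\<close>, on the event of no exit up to then. Integrating out the next
  step gives \<open>e (Suc k) \<ge> l * e k\<close>, while \<open>e 0 = 1\<close>; bounding
  \<open>cos_bump r\<close> by 1 at time \<open>n\<close> leaves the probability.\<close>

lemma (in prob_space) cos_excessive_walk:
  fixes X :: "nat \<Rightarrow> 'a \<Rightarrow> real"
  assumes r: "0 < r"
    and ind: "indep_vars (\<lambda>_. borel) X {..<n}"
    and distr: "\<And>i. i < n \<Longrightarrow> distr M borel (X i) = \<mu>"
    and l: "0 \<le> l" "\<And>x. l * cos_bump r x \<le> (\<integral>y. cos_bump r (x + y) \<partial>\<mu>)"
  shows "l ^ n \<le> prob {\<omega>\<in>space M. \<forall>k\<le>n. \<bar>\<Sum>i<k. X i \<omega>\<bar> \<le> r}"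
proof -
  have rv[measurable]: "i < n \<Longrightarrow> X i \<in> borel_measurable M" for i
    using ind by (auto simp: indep_vars_def)
  define J :: "nat \<Rightarrow> (nat \<Rightarrow> real) \<Rightarrow> real" where
    "J k x = of_bool (\<forall>j\<in>{..k}. \<bar>\<Sum>i<j. x i\<bar> \<le> r)" for k x
  define e where "e k = expectation (\<lambda>\<omega>. J k (\<lambda>i. X i \<omega>) * cos_bump r (\<Sum>i<k. X i \<omega>))" for k
  have J01: "0 \<le> J k x" "J k x \<le> 1" for k x
    by (auto simp: J_def)
  have meas_sum: "(\<lambda>\<omega>. \<Sum>i<j. X i \<omega>) \<in> borel_measurable M" if "j \<le> n" for j
    using that by (intro borel_measurable_sum rv) auto
  have meas_J: "(\<lambda>\<omega>. J k (\<lambda>i. X i \<omega>)) \<in> borel_measurable M" if k: "k \<le> n" for k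
  proof -
    have "Measurable.pred M (\<lambda>\<omega>. \<bar>\<Sum>i<j. X i \<omega>\<bar> \<le> r)" if "j \<in> {..k}" for j
    proof -
      have [measurable]: "(\<lambda>\<omega>. \<Sum>i<j. X i \<omega>) \<in> borel_measurable M"
        using that k by (intro meas_sum) auto
      show ?thesis by measurable
    qed
    then have "Measurable.pred M (\<lambda>\<omega>. \<forall>j\<in>{..k}. \<bar>\<Sum>i<j. X i \<omega>\<bar> \<le> r)"
      by (intro pred_intros_finite) auto
    then show ?thesis
      unfolding J_def of_bool_def by (intro measurable_If) auto
  qed
  have "l ^ k \<le> e k" if "k \<le> n" for k
    using that
  proof (induction k)
    case 0
    then show ?case
      using r by (simp add: e_def J_def cos_bump_def prob_space)
  next
    case (Suc k)
    then have k: "k < n" by simp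
    define G where "G x = (J k x, \<Sum>i<k. x i)" for x
    have G_meas: "G \<in> measurable (PiM {..<k} (\<lambda>_. borel)) (borel \<Otimes>\<^sub>M borel)"
    proof -
      have [measurable]: "(\<lambda>x. \<Sum>i<j. x i) \<in> borel_measurable (PiM {..<k} (\<lambda>_. borel::real measure))" if "j \<le> k" for j
        using that by (intro borel_measurable_sum measurable_component_singleton) auto
      have "Measurable.pred (PiM {..<k} (\<lambda>_. borel)) (\<lambda>x. \<forall>j\<in>{..k}. \<bar>\<Sum>i<j. x i\<bar> \<le> r)"
        by (intro pred_intros_finite) auto
      then have "J k \<in> borel_measurable (PiM {..<k} (\<lambda>_. borel))"
        unfolding J_def[abs_def] of_bool_def by (intro measurable_If) auto
      then show ?thesis
        unfolding G_def by measurable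
    qed
    \<comment> \<open>\<open>indep_var\<close> forces both variables to have the same type, hence the dummy component \<open>0\<close>.\<close>
    have "indep_var (borel \<Otimes>\<^sub>M borel) (G \<circ> (\<lambda>\<omega>. restrict (\<lambda>i. X i \<omega>) {..<k}))
        (borel \<Otimes>\<^sub>M borel) ((\<lambda>x. (0, x k)) \<circ> (\<lambda>\<omega>. restrict (\<lambda>i. X i \<omega>) {k}))"
      using k by (intro indep_var_compose[OF indep_var_restrict[OF ind]] G_meas) auto
    moreover have "G \<circ> (\<lambda>\<omega>. restrict (\<lambda>i. X i \<omega>) {..<k}) = (\<lambda>\<omega>. (J k (\<lambda>i. X i \<omega>), \<Sum>i<k. X i \<omega>))"
      by (auto simp: G_def J_def fun_eq_iff)
    moreover have "(\<lambda>x. (0::real, x k)) \<circ> (\<lambda>\<omega>. restrict (\<lambda>i. X i \<omega>) {k}) = (\<lambda>\<omega>. (0, X k \<omega>))"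
      by auto
    ultimately have ind': "indep_var (borel \<Otimes>\<^sub>M borel) (\<lambda>\<omega>. (J k (\<lambda>i. X i \<omega>), \<Sum>i<k. X i \<omega>))
        (borel \<Otimes>\<^sub>M borel) (\<lambda>\<omega>. (0, X k \<omega>))"
      by simp
    \<comment> \<open>The test \<open>fst (fst p) = 1\<close> agrees with \<open>J k\<close>, whose
      values are 0 and 1, and keeps \<open>f\<close> bounded by 1 on the whole product space, as
      \<open>indep_var_expectation\<close> requires.\<close>
    define f :: "(real \<times> real) \<times> real \<times> real \<Rightarrow> real"
      where "f = (\<lambda>p. of_bool (fst (fst p) = 1) * cos_bump r (snd (fst p) + snd (snd p)))"
    have f_meas: "f \<in> borel_measurable ((borel \<Otimes>\<^sub>M borel) \<Otimes>\<^sub>M (borel \<Otimes>\<^sub>M borel))"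
      unfolding f_def of_bool_def by measurable
    have J_eq: "of_bool (J k x = 1) = J k x" for x
      by (simp add: J_def)
    have "e (Suc k) = expectation (\<lambda>\<omega>. f ((J k (\<lambda>i. X i \<omega>), \<Sum>i<k. X i \<omega>), (0, X k \<omega>)))"
      unfolding e_def f_def
      by (intro Bochner_Integration.integral_cong) (auto simp: J_def cos_bump_def le_Suc_eq)
    also have "\<dots> = expectation (\<lambda>\<omega>. expectation (\<lambda>\<omega>'. f ((J k (\<lambda>i. X i \<omega>), \<Sum>i<k. X i \<omega>), (0, X k \<omega>'))))"
      by (rule indep_var_expectation[OF ind' f_meas]) (auto simp: f_def abs_cos_bump_le_1)
    also have "\<dots> = expectation (\<lambda>\<omega>. J k (\<lambda>i. X i \<omega>) * (\<integral>y. cos_bump r ((\<Sum>i<k. X i \<omega>) + y) \<partial>\<mu>))"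
      using k by (simp add: f_def J_eq integral_distr flip: distr[OF k])
    finally have e_Suc: "e (Suc k) = expectation (\<lambda>\<omega>. J k (\<lambda>i. X i \<omega>) * (\<integral>y. cos_bump r ((\<Sum>i<k. X i \<omega>) + y) \<partial>\<mu>))" .
    interpret \<mu>: prob_space \<mu>
      using prob_space_distr[OF rv[OF k]] distr[OF k] by simp
    have \<mu>_sets[measurable_cong]: "sets \<mu> = sets borel"
      using distr[OF k] by (metis sets_distr)
    have bound: "\<bar>\<integral>y. cos_bump r (x + y) \<partial>\<mu>\<bar> \<le> 1" for x
      by (rule \<mu>.abs_expectation_le_1) (auto simp: abs_cos_bump_le_1)
    note [measurable] = meas_J[OF less_imp_le[OF k]] meas_sum[OF less_imp_le[OF k]]
    have "l ^ Suc k \<le> l * e k"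
      using Suc k l(1) by (simp add: mult_left_mono)
    also have "\<dots> = expectation (\<lambda>\<omega>. J k (\<lambda>i. X i \<omega>) * (l * cos_bump r (\<Sum>i<k. X i \<omega>)))"
      unfolding e_def by (subst integral_mult_right_zero[symmetric]) (simp add: mult_ac)
    also have "\<dots> \<le> e (Suc k)"
      unfolding e_Suc
    proof (rule integral_mono)
      show "integrable M (\<lambda>\<omega>. J k (\<lambda>i. X i \<omega>) * (l * cos_bump r (\<Sum>i<k. X i \<omega>)))"
      proof (rule integrable_const_bound[where B=l])
        show "AE \<omega> in M. norm (J k (\<lambda>i. X i \<omega>) * (l * cos_bump r (\<Sum>i<k. X i \<omega>))) \<le> l"
          using l(1) J01 cos_bump_nonneg cos_bump_le_1
          by (intro always_eventually allI) (auto simp: abs_mult J_def mult_left_le)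
      qed measurable
      show "integrable M (\<lambda>\<omega>. J k (\<lambda>i. X i \<omega>) * (\<integral>y. cos_bump r ((\<Sum>i<k. X i \<omega>) + y) \<partial>\<mu>))"
      proof (rule integrable_const_bound[where B=1])
        show "AE \<omega> in M. norm (J k (\<lambda>i. X i \<omega>) * (\<integral>y. cos_bump r ((\<Sum>i<k. X i \<omega>) + y) \<partial>\<mu>)) \<le> 1"
          using bound by (intro always_eventually allI) (auto simp: abs_mult J_def)
      qed measurable
    qed (intro mult_left_mono l(2) J01)
    finally show ?case .
  qed
  then have "l ^ n \<le> e n" by simp
  also have "\<dots> \<le> expectation (\<lambda>\<omega>. J n (\<lambda>i. X i \<omega>))"
    unfolding e_def
  proof (rule integral_mono)
    note [measurable] = meas_J[OF order_refl] meas_sum[OF order_refl]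
    show "integrable M (\<lambda>\<omega>. J n (\<lambda>i. X i \<omega>) * cos_bump r (\<Sum>i<n. X i \<omega>))"
      by (rule integrable_const_bound[where B=1]) (auto simp: J_def abs_mult abs_cos_bump_le_1)
    show "integrable M (\<lambda>\<omega>. J n (\<lambda>i. X i \<omega>))"
      by (rule integrable_const_bound[where B=1]) (auto simp: J_def)
  qed (auto simp: J_def cos_bump_le_1)
  also have "\<dots> = expectation (indicator {\<omega>\<in>space M. \<forall>k\<le>n. \<bar>\<Sum>i<k. X i \<omega>\<bar> \<le> r})"
    by (intro Bochner_Integration.integral_cong) (auto simp: J_def indicator_def)
  also have "\<dots> = prob {\<omega>\<in>space M. \<forall>k\<le>n. \<bar>\<Sum>i<k. X i \<omega>\<bar> \<le> r}"
    by (simp add: Int_absorb2 Int_absorb1 subset_eq)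
  finally show ?thesis .
qed

section \<open>Small balls of the stable process\<close>

text \<open>The successor makes the dyadic point strictly larger than \<open>t \<ge> 0\<close>, so
  that right limits of paths apply to it.\<close>

definition dyadic_above :: "nat \<Rightarrow> real \<Rightarrow> real" where
  "dyadic_above n t = real (Suc (nat \<lfloor>2 ^ n * t\<rfloor>)) / 2 ^ n"

lemma dyadic_above_bounds:
  assumes "0 \<le> t"
  shows "t < dyadic_above n t" "dyadic_above n t \<le> t + (1 / 2) ^ n"
proof -
  have eq: "real (Suc (nat \<lfloor>2 ^ n * t\<rfloor>)) = of_int \<lfloor>2 ^ n * t\<rfloor> + 1"
    using assms by simp
  have "2 ^ n * t < of_int \<lfloor>2 ^ n * t\<rfloor> + 1" "of_int \<lfloor>2 ^ n * t\<rfloor> \<le> 2 ^ n * t"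
    by linarith+
  then show "t < dyadic_above n t" "dyadic_above n t \<le> t + (1 / 2) ^ n"
    unfolding dyadic_above_def eq by (simp_all add: field_simps)
qed

lemma filterlim_dyadic_above:
  assumes "0 \<le> t"
  shows "filterlim (\<lambda>n. dyadic_above n t) (at_right t) sequentially"
  unfolding filterlim_at
proof
  show "\<forall>\<^sub>F n in sequentially. dyadic_above n t \<in> {t<..} \<and> dyadic_above n t \<noteq> t"
    using dyadic_above_bounds(1)[OF assms] by (intro always_eventually) (auto simp: less_imp_neq[THEN not_sym])
  have "(\<lambda>n. t + (1 / 2) ^ n) \<longlonglongrightarrow> t + 0"
    by (intro tendsto_intros LIMSEQ_power_zero) simp
  then have lim: "(\<lambda>n. t + (1 / 2) ^ n) \<longlonglongrightarrow> t" by simp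
  show "(\<lambda>n. dyadic_above n t) \<longlonglongrightarrow> t"
    by (rule tendsto_sandwich[OF _ _ tendsto_const lim])
       (simp_all add: dyadic_above_bounds[OF assms] less_imp_le)
qed

lemma dyadic_above_le_1:
  assumes "0 \<le> t" "t < 1"
  shows "Suc (nat \<lfloor>2 ^ n * t\<rfloor>) \<le> 2 ^ n"
proof -
  have "\<lfloor>2 ^ n * t\<rfloor> < 2 ^ n"
    using assms by (simp add: floor_less_iff)
  then show ?thesis using assms
    by (simp add: Suc_le_eq nat_less_iff)
qed

text \<open>A time \<open>t < 1\<close> is a limit from the right of dyadic points that remain in
  \<open>[0, 1]\<close>; the endpoint 1, which has no such approximation, is itself dyadic.\<close>

lemma right_continuous_dyadic_closed:
  fixes f :: "real \<Rightarrow> 'b::topological_space"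
  assumes cont: "\<And>t. 0 \<le> t \<Longrightarrow> (f \<longlongrightarrow> f t) (at_right t)"
    and C: "closed C" "\<And>n k. k \<le> 2 ^ n \<Longrightarrow> f (real k / 2 ^ n) \<in> C"
    and t: "t \<in> {0..1}"
  shows "f t \<in> C"
proof (cases "t = 1")
  case True
  then show ?thesis using C(2)[of 1 0] by simp
next
  case False
  have "(\<lambda>n. f (dyadic_above n t)) \<longlonglongrightarrow> f t"
    using t by (intro filterlim_compose[OF cont filterlim_dyadic_above]) auto
  moreover have "f (dyadic_above n t) \<in> C" for n
    unfolding dyadic_above_def using t False by (intro C(2) dyadic_above_le_1) auto
  ultimately show ?thesis
    by (intro Lim_in_closed_set[OF C(1)]) (auto intro!: always_eventually)
qed

section \<open>Supremum and oscillation of a path through its values at dyadic times\<close>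

lemma levy_processD:
  assumes "levy_process M Z"
  shows "prob_space M" "\<And>t. 0 \<le> t \<Longrightarrow> Z t \<in> borel_measurable M"
    "\<And>\<omega>. \<omega> \<in> space M \<Longrightarrow> Z 0 \<omega> = 0"
    "\<And>\<omega> t. \<omega> \<in> space M \<Longrightarrow> 0 \<le> t \<Longrightarrow> ((\<lambda>t. Z t \<omega>) \<longlongrightarrow> Z t \<omega>) (at_right t)"
    "\<And>s t. 0 \<le> s \<Longrightarrow> s \<le> t \<Longrightarrow> distr M borel (\<lambda>\<omega>. Z t \<omega> - Z s \<omega>) = distr M borel (Z (t - s))"
    "\<And>n \<tau>. 0 \<le> \<tau> 0 \<Longrightarrow> mono \<tau> \<Longrightarrow>
      prob_space.indep_vars M (\<lambda>_. borel) (\<lambda>i \<omega>. Z (\<tau> (Suc i)) \<omega> - Z (\<tau> i) \<omega>) {..<n}"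
  using assms unfolding levy_process_def cadlag_def by auto

lemma sup_norm_le_iff: "sup_norm Z \<omega> \<le> ereal e \<longleftrightarrow> (\<forall>t\<in>{0..1}. \<bar>Z t \<omega>\<bar> \<le> e)"
  unfolding sup_norm_def by (simp add: SUP_le_iff)

text \<open>Unordered pairs reduce to \<open>s < t\<close> by symmetry, and \<open>0 \<le> e\<close>
  covers \<open>s = t\<close>.\<close>

lemma oscillation_le_iff:
  assumes "0 \<le> e"
  shows "oscillation Z \<omega> \<le> ereal e \<longleftrightarrow> (\<forall>s\<in>{0..1}. \<forall>t\<in>{0..1}. \<bar>Z t \<omega> - Z s \<omega>\<bar> \<le> e)"
proof
  assume L: "oscillation Z \<omega> \<le> ereal e"
  have "\<bar>Z t \<omega> - Z s \<omega>\<bar> \<le> e" if "s \<in> {0..1}" "t \<in> {0..1}" "s < t" for s t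
    using L that unfolding oscillation_def SUP_le_iff by auto
  then show "\<forall>s\<in>{0..1}. \<forall>t\<in>{0..1}. \<bar>Z t \<omega> - Z s \<omega>\<bar> \<le> e"
    using assms by (metis abs_minus_commute abs_zero diff_self linorder_neqE_linordered_idom)
qed (auto simp: oscillation_def SUP_le_iff)

text \<open>Right continuity and a closed ball reduce the condition to countably many times, which
  serves both measurability and the limit along dyadic grids.\<close>

lemma sup_norm_le_iff_dyadic:
  assumes Z: "levy_process M Z" and \<omega>: "\<omega> \<in> space M"
  shows "sup_norm Z \<omega> \<le> ereal e \<longleftrightarrow> (\<forall>n. \<forall>k\<le>2 ^ n. \<bar>Z (real k / 2 ^ n) \<omega>\<bar> \<le> e)"
  unfolding sup_norm_le_iff
proof (intro iffI allI impI ballI)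
  fix t :: real
  assume *: "\<forall>n. \<forall>k\<le>2 ^ n. \<bar>Z (real k / 2 ^ n) \<omega>\<bar> \<le> e" and t: "t \<in> {0..1}"
  have "Z t \<omega> \<in> cball 0 e"
    by (rule right_continuous_dyadic_closed[of "\<lambda>t. Z t \<omega>", OF levy_processD(4)[OF Z \<omega>] closed_cball _ t])
       (simp_all add: *)
  then show "\<bar>Z t \<omega>\<bar> \<le> e" by simp
next
  fix n k :: nat
  assume *: "\<forall>t\<in>{0..1}. \<bar>Z t \<omega>\<bar> \<le> e" and "k \<le> 2 ^ n"
  then have "real k \<le> 2 ^ n" by simp
  then show "\<bar>Z (real k / 2 ^ n) \<omega>\<bar> \<le> e" using * by simp
qed

text \<open>The closed-ball argument is applied twice: in \<open>t\<close> with the other time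
  dyadic, then in \<open>s\<close> with \<open>t\<close> fixed.\<close>

lemma oscillation_le_iff_dyadic:
  assumes Z: "levy_process M Z" and \<omega>: "\<omega> \<in> space M" and e: "0 \<le> e"
  shows "oscillation Z \<omega> \<le> ereal e \<longleftrightarrow> (\<forall>m n j k. j \<le> 2 ^ m \<longrightarrow> k \<le> 2 ^ n \<longrightarrow>
    \<bar>Z (real k / 2 ^ n) \<omega> - Z (real j / 2 ^ m) \<omega>\<bar> \<le> e)"
  unfolding oscillation_le_iff[OF e]
proof (intro iffI allI impI ballI)
  fix s t :: real
  assume *: "\<forall>m n j k. j \<le> 2 ^ m \<longrightarrow> k \<le> 2 ^ n \<longrightarrow> \<bar>Z (real k / 2 ^ n) \<omega> - Z (real j / 2 ^ m) \<omega>\<bar> \<le> e"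
    and s: "s \<in> {0..1}" and t: "t \<in> {0..1}"
  note closedI = right_continuous_dyadic_closed[of "\<lambda>t. Z t \<omega>", OF levy_processD(4)[OF Z \<omega>] closed_cball]
  have "Z t \<omega> \<in> cball (Z (real j / 2 ^ m) \<omega>) e" if "j \<le> 2 ^ m" for j m
    by (rule closedI[OF _ _ t], assumption)
       (use * that in \<open>simp add: dist_real_def abs_minus_commute\<close>)
  then have "Z (real j / 2 ^ m) \<omega> \<in> cball (Z t \<omega>) e" if "j \<le> 2 ^ m" for j m
    using that by (simp add: dist_commute)
  then have "Z s \<omega> \<in> cball (Z t \<omega>) e"
    by (rule closedI[OF _ _ s, rotated]) assumption
  then show "\<bar>Z t \<omega> - Z s \<omega>\<bar> \<le> e" by (simp add: dist_real_def)
next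
  fix m n j k :: nat
  assume *: "\<forall>s\<in>{0..1}. \<forall>t\<in>{0..1}. \<bar>Z t \<omega> - Z s \<omega>\<bar> \<le> e" and "j \<le> 2 ^ m" "k \<le> 2 ^ n"
  then have "real j \<le> 2 ^ m" "real k \<le> 2 ^ n"
    by simp_all
  then show "\<bar>Z (real k / 2 ^ n) \<omega> - Z (real j / 2 ^ m) \<omega>\<bar> \<le> e" using * by simp
qed

section \<open>Measurability of the small-ball events\<close>

lemma sup_norm_le_in_sets:
  assumes Z: "levy_process M Z"
  shows "{\<omega>\<in>space M. sup_norm Z \<omega> \<le> ereal e} \<in> sets M"
proof -
  have [measurable]: "Z (real k / 2 ^ n) \<in> borel_measurable M" for k n
    using levy_processD(2)[OF Z] by simp
  have "{\<omega>\<in>space M. sup_norm Z \<omega> \<le> ereal e}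
      = {\<omega>\<in>space M. \<forall>n k. k \<le> 2 ^ n \<longrightarrow> \<bar>Z (real k / 2 ^ n) \<omega>\<bar> \<le> e}"
    using sup_norm_le_iff_dyadic[OF Z] by auto
  also have "\<dots> \<in> sets M" by measurable
  finally show ?thesis .
qed

lemma oscillation_le_in_sets:
  assumes Z: "levy_process M Z" and e: "0 \<le> e"
  shows "{\<omega>\<in>space M. oscillation Z \<omega> \<le> ereal e} \<in> sets M"
proof -
  have [measurable]: "Z (real k / 2 ^ n) \<in> borel_measurable M" for k n
    using levy_processD(2)[OF Z] by simp
  have "{\<omega>\<in>space M. oscillation Z \<omega> \<le> ereal e} = {\<omega>\<in>space M. \<forall>m n j k. j \<le> 2 ^ m \<longrightarrow> k \<le> 2 ^ n \<longrightarrow>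
      \<bar>Z (real k / 2 ^ n) \<omega> - Z (real j / 2 ^ m) \<omega>\<bar> \<le> e}"
    by (intro Collect_cong conj_cong refl oscillation_le_iff_dyadic[OF Z _ e])
  also have "\<dots> \<in> sets M" by measurable
  finally show ?thesis .
qed

text \<open>On \<open>[0, 1]\<close> the process is the pointwise limit of its values at
  \<open>dyadic_above n t\<close>, by right continuity. The indicator removes negative times, at
  which paths are unconstrained.\<close>

lemma levy_process_jointly_measurable:
  assumes Z: "levy_process M Z"
  shows "(\<lambda>(\<omega>, t). indicator {0..1} t * Z t \<omega>) \<in> borel_measurable (M \<Otimes>\<^sub>M (lborel :: real measure))"
proof (rule borel_measurable_LIMSEQ_real)
  define g where "g n = (\<lambda>(\<omega>, t). indicator {0..1} t * Z (dyadic_above n t) \<omega>)" for n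
  show "g n \<in> borel_measurable (M \<Otimes>\<^sub>M lborel)" for n
  proof -
    have "(\<lambda>p. Z (real (Suc k) / 2 ^ n) (fst p)) \<in> borel_measurable (M \<Otimes>\<^sub>M lborel)" for k
      by (rule measurable_compose[OF measurable_fst levy_processD(2)[OF Z]]) simp
    moreover have "(\<lambda>p::_ \<times> real. nat \<lfloor>2 ^ n * snd p\<rfloor>) \<in> measurable (M \<Otimes>\<^sub>M lborel) (count_space UNIV)"
      by measurable
    \<comment> \<open>The index depends measurably on time and takes countably many values, and for
      each fixed index the variable is measurable.\<close>
    ultimately have [measurable]: "(\<lambda>p::_ \<times> real. Z (real (Suc (nat \<lfloor>2 ^ n * snd p\<rfloor>)) / 2 ^ n) (fst p)) \<in> borel_measurable (M \<Otimes>\<^sub>M lborel)"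
      by (rule measurable_compose_countable)
    show ?thesis
      unfolding g_def dyadic_above_def split_beta' by measurable
  qed
  fix p assume "p \<in> space (M \<Otimes>\<^sub>M (lborel :: real measure))"
  then obtain \<omega> t where p: "p = (\<omega>, t)" "\<omega> \<in> space M"
    by (auto simp: space_pair_measure)
  show "(\<lambda>n. g n p) \<longlonglongrightarrow> (case p of (\<omega>, t) \<Rightarrow> indicator {0..1} t * Z t \<omega>)"
  proof (cases "t \<in> {0..1}")
    case True
    then show ?thesis
      using filterlim_compose[OF levy_processD(4)[OF Z p(2)] filterlim_dyadic_above, of t]
      by (simp add: g_def p(1))
  qed (simp add: g_def p(1))
qed

lemma L2_path_norm_le_in_sets:
  assumes Z: "levy_process M Z"
  shows "{\<omega>\<in>space M. L2_path_norm Z \<omega> \<le> ereal e} \<in> sets M"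
proof -
  note [measurable] = levy_process_jointly_measurable[OF Z]
  have "(\<lambda>\<omega>. \<integral>t. (indicator {0..1} t * Z t \<omega>)\<^sup>2 \<partial>lborel) \<in> borel_measurable M"
    by measurable
  moreover have "(LINT t:{0..1}|lborel. (Z t \<omega>)\<^sup>2) = (\<integral>t. (indicator {0..1} t * Z t \<omega>)\<^sup>2 \<partial>lborel)" for \<omega>
    unfolding set_lebesgue_integral_def
    by (intro Bochner_Integration.integral_cong) (auto simp: indicator_def)
  ultimately have [measurable]: "(\<lambda>\<omega>. LINT t:{0..1}|lborel. (Z t \<omega>)\<^sup>2) \<in> borel_measurable M"
    by simp
  show ?thesis unfolding L2_path_norm_def by simp
qed

lemma L2_path_norm_le:
  assumes e: "0 \<le> e" and le: "sup_norm Z \<omega> \<le> ereal e"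
  shows "L2_path_norm Z \<omega> \<le> ereal e"
proof -
  have "(LINT t:{0..1}|lborel. (Z t \<omega>)\<^sup>2) \<le> e\<^sup>2"
  proof (cases "set_integrable lborel {0..1} (\<lambda>t. (Z t \<omega>)\<^sup>2)")
    case True
    have "(LINT t:{0..1}|lborel. (Z t \<omega>)\<^sup>2) \<le> (LINT t:{0..1::real}|lborel. e\<^sup>2)"
    proof (rule set_integral_mono[OF True])
      show "set_integrable lborel {0..1::real} (\<lambda>_. e\<^sup>2)"
        by (simp add: set_integrable_def)
      show "(Z t \<omega>)\<^sup>2 \<le> e\<^sup>2" if "t \<in> {0..1}" for t
        using that le by (auto simp: sup_norm_le_iff intro!: power2_le_iff_abs_le[THEN iffD2] e)
    qed
    then show ?thesis by (simp add: set_lebesgue_integral_def)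
  next
    case False
    \<comment> \<open>The integral of a non-integrable function is 0 by default, so the bound is
      trivial here.\<close>
    then have "(LINT t:{0..1}|lborel. (Z t \<omega>)\<^sup>2) = 0"
      unfolding set_integrable_def set_lebesgue_integral_def by (rule not_integrable_integral_eq)
    then show ?thesis by simp
  qed
  then have "sqrt (LINT t:{0..1}|lborel. (Z t \<omega>)\<^sup>2) \<le> sqrt (e\<^sup>2)"
    by (rule real_sqrt_le_mono)
  then show ?thesis
    unfolding L2_path_norm_def using e by simp
qed

section \<open>Lower bounds for the small-ball probabilities\<close>

lemma stable_levy_processD:
  assumes "stable_levy_process M Z \<alpha> \<kappa>"
  shows "levy_process M Z"
    "\<And>t \<xi>. 0 \<le> t \<Longrightarrow> char (distr M borel (Z t)) \<xi> = complex_of_real (exp (- \<kappa> * t * \<bar>\<xi>\<bar> powr \<alpha>))"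
  using assms unfolding stable_levy_process_def by auto

text \<open>Each of the \<open>N\<close> grid increments has the factor
  \<open>exp (- (\<kappa> / N) * (pi / (2 * r)) powr \<alpha>)\<close>, so the bound after
  \<open>N\<close> steps does not depend on the mesh.\<close>

lemma stable_dyadic_small_ball_ge:
  assumes \<alpha>: "0 < \<alpha>" "\<alpha> < 2" and \<kappa>: "0 < \<kappa>" and stable: "stable_levy_process M Z \<alpha> \<kappa>" and r: "0 < r"
  shows "exp (- \<kappa> * (pi / (2 * r)) powr \<alpha>)
    \<le> measure M {\<omega>\<in>space M. \<forall>k\<le>2 ^ n. \<bar>Z (real k / 2 ^ n) \<omega>\<bar> \<le> r}"
proof -
  note Z = stable_levy_processD(1)[OF stable]
  interpret prob_space M by (rule levy_processD(1)[OF Z])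
  define N :: nat where "N = 2 ^ n"
  have N: "0 < N" "real N = 2 ^ n" by (simp_all add: N_def)
  define \<mu> where "\<mu> = distr M borel (Z (1 / N))"
  define X where "X i \<omega> = Z (real (Suc i) / N) \<omega> - Z (real i / N) \<omega>" for i \<omega>
  have \<mu>: "real_distribution \<mu>"
    unfolding \<mu>_def using levy_processD(2)[OF Z] by (intro real_distribution_distr) simp
  have char_\<mu>: "char \<mu> t = complex_of_real (exp (- (\<kappa> / N) * \<bar>t\<bar> powr \<alpha>))" for t
    unfolding \<mu>_def using stable_levy_processD(2)[OF stable, of "1 / N" t] by simp
  have "cos_excessive r \<mu>"
    by (rule stable_cos_excessive[OF \<alpha> r _ \<mu> char_\<mu>]) (use \<kappa> N in simp)
  then obtain l where l: "0 \<le> l" "char \<mu> (pi / (2 * r)) = complex_of_real l"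
    "\<And>x. l * cos_bump r x \<le> (\<integral>y. cos_bump r (x + y) \<partial>\<mu>)"
    unfolding cos_excessive_def by blast
  have "l = exp (- (\<kappa> / N) * (pi / (2 * r)) powr \<alpha>)"
    using l(2) r unfolding char_\<mu> of_real_eq_iff by simp
  then have "l ^ N = exp (- \<kappa> * (pi / (2 * r)) powr \<alpha>)"
    using N by (simp flip: exp_of_nat_mult)
  moreover have "l ^ N \<le> prob {\<omega>\<in>space M. \<forall>k\<le>N. \<bar>\<Sum>i<k. X i \<omega>\<bar> \<le> r}"
  proof (rule cos_excessive_walk[OF r _ _ l(1,3)])
    show "indep_vars (\<lambda>_. borel) X {..<N}"
      unfolding X_def[abs_def]
      by (rule levy_processD(6)[OF Z, of "\<lambda>i. real i / N"]) (auto simp: mono_def divide_right_mono)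
    show "distr M borel (X i) = \<mu>" for i
      unfolding X_def[abs_def] \<mu>_def
      by (subst levy_processD(5)[OF Z]) (auto simp: divide_right_mono simp flip: diff_divide_distrib)
  qed
  moreover have "(\<Sum>i<k. X i \<omega>) = Z (real k / N) \<omega>" if "\<omega> \<in> space M" for k \<omega>
    using levy_processD(3)[OF Z that] unfolding X_def
    by (subst sum_lessThan_telescope[of "\<lambda>i. Z (real i / N) \<omega>"]) simp
  then have "{\<omega>\<in>space M. \<forall>k\<le>N. \<bar>\<Sum>i<k. X i \<omega>\<bar> \<le> r}
      = {\<omega>\<in>space M. \<forall>k\<le>2 ^ n. \<bar>Z (real k / 2 ^ n) \<omega>\<bar> \<le> r}"
    by (auto simp: N_def)
  ultimately show ?thesis by simp
qed

text \<open>The grid events decrease to the event for the whole path, and the uniform bound passes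
  to their intersection by continuity from above.\<close>

lemma stable_small_ball_ge:
  assumes \<alpha>: "0 < \<alpha>" "\<alpha> < 2" and \<kappa>: "0 < \<kappa>" and stable: "stable_levy_process M Z \<alpha> \<kappa>" and r: "0 < r"
  shows "exp (- \<kappa> * (pi / (2 * r)) powr \<alpha>) \<le> measure M {\<omega>\<in>space M. sup_norm Z \<omega> \<le> ereal r}"
proof -
  note Z = stable_levy_processD(1)[OF stable]
  interpret prob_space M by (rule levy_processD(1)[OF Z])
  define A where "A n = {\<omega>\<in>space M. \<forall>k\<le>2 ^ n. \<bar>Z (real k / 2 ^ n) \<omega>\<bar> \<le> r}" for n :: nat
  have [measurable]: "Z (real k / 2 ^ n) \<in> borel_measurable M" for k n
    using levy_processD(2)[OF Z] by simp
  have "A n \<in> sets M" for n unfolding A_def by measurable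
  moreover have "decseq A"
  proof (rule decseq_SucI)
    show "A (Suc n) \<subseteq> A n" for n
    proof
      fix \<omega> assume \<omega>: "\<omega> \<in> A (Suc n)"
      have "\<bar>Z (real k / 2 ^ n) \<omega>\<bar> \<le> r" if "k \<le> 2 ^ n" for k
      proof -
        have "real (2 * k) / 2 ^ Suc n = real k / 2 ^ n" by simp
        moreover have "2 * k \<le> 2 ^ Suc n" using that by simp
        ultimately show ?thesis using \<omega> unfolding A_def by (metis (mono_tags, lifting) mem_Collect_eq)
      qed
      then show "\<omega> \<in> A n" using \<omega> by (simp add: A_def)
    qed
  qed
  ultimately have "(\<lambda>n. prob (A n)) \<longlonglongrightarrow> prob (\<Inter>n. A n)"
    by (intro finite_Lim_measure_decseq) auto
  moreover have "(\<Inter>n. A n) = {\<omega>\<in>space M. sup_norm Z \<omega> \<le> ereal r}"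
    using sup_norm_le_iff_dyadic[OF Z] by (auto simp: A_def)
  moreover have "exp (- \<kappa> * (pi / (2 * r)) powr \<alpha>) \<le> prob (A n)" for n
    unfolding A_def by (rule stable_dyadic_small_ball_ge[OF \<alpha> \<kappa> stable r])
  ultimately show ?thesis
    by (intro LIMSEQ_le_const) auto
qed

text \<open>Young's inequality with weights \<open>\<alpha> / 2\<close> and
  \<open>(2 - \<alpha>) / 2\<close>. In fact \<open>d_const \<alpha> \<kappa>\<close> is the maximum
  of \<open>\<kappa> * a powr \<alpha> - a\<^sup>2 / 2\<close> over \<open>a > 0\<close>, attained
  where \<open>a powr (2 - \<alpha>) = \<alpha> * \<kappa>\<close>.\<close>

lemma d_const_ge:
  assumes \<alpha>: "0 < \<alpha>" "\<alpha> < 2" and \<kappa>: "0 < \<kappa>" and a: "0 < a"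
  shows "\<kappa> * a powr \<alpha> \<le> a\<^sup>2 / 2 + d_const \<alpha> \<kappa>"
proof -
  \<comment> \<open>Its weighted power is \<open>\<alpha> powr (\<alpha> / 2) * \<kappa>\<close>,
    which cancels the denominator coming from \<open>a\<^sup>2 / \<alpha>\<close>.\<close>
  define B where "B = \<alpha> powr (\<alpha> / (2 - \<alpha>)) * \<kappa> powr (2 / (2 - \<alpha>))"
  have "(a\<^sup>2 / \<alpha>) powr (\<alpha> / 2) * B powr ((2 - \<alpha>) / 2) \<le> \<alpha> / 2 * (a\<^sup>2 / \<alpha>) + (2 - \<alpha>) / 2 * B"
    using assms by (intro Youngs_inequality_0) (auto simp: B_def field_simps)
  moreover have "B powr ((2 - \<alpha>) / 2) = \<alpha> powr (\<alpha> / 2) * \<kappa>"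
  proof -
    have "\<alpha> / (2 - \<alpha>) * ((2 - \<alpha>) / 2) = \<alpha> / 2" "2 / (2 - \<alpha>) * ((2 - \<alpha>) / 2) = 1"
      using \<alpha> by simp_all
    then show ?thesis
      unfolding B_def using \<alpha> \<kappa> by (simp only: powr_mult powr_powr) simp
  qed
  moreover have "(a\<^sup>2 / \<alpha>) powr (\<alpha> / 2) = a powr \<alpha> / \<alpha> powr (\<alpha> / 2)"
    using assms by (simp add: powr_divide powr_powr flip: powr_numeral)
  moreover have "(2 - \<alpha>) / 2 * B = d_const \<alpha> \<kappa>"
    by (simp add: d_const_def B_def)
  moreover have "a powr \<alpha> / \<alpha> powr (\<alpha> / 2) * (\<alpha> powr (\<alpha> / 2) * \<kappa>) = \<kappa> * a powr \<alpha>"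
    using \<alpha> by simp
  moreover have "\<alpha> / 2 * (a\<^sup>2 / \<alpha>) = a\<^sup>2 / 2"
    using \<alpha> by simp
  ultimately show ?thesis by (simp only:)
qed

section \<open>Passage to the logarithmic scale and conclusion\<close>

lemma log_prob_mono:
  assumes "0 \<le> p" "p \<le> q"
  shows "log_prob p \<le> log_prob q"
  using assms by (auto simp: log_prob_def)

lemma scaled_log_small_ball_mono:
  assumes "prob_space M" "{\<omega>\<in>space M. N' \<omega> \<le> ereal \<epsilon>} \<in> sets M"
    and "\<And>\<omega>. \<omega> \<in> space M \<Longrightarrow> N \<omega> \<le> ereal \<epsilon> \<Longrightarrow> N' \<omega> \<le> ereal \<epsilon>"
  shows "scaled_log_small_ball M \<alpha> N \<epsilon> \<le> scaled_log_small_ball M \<alpha> N' \<epsilon>"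
proof -
  interpret prob_space M by fact
  show ?thesis
    unfolding scaled_log_small_ball_def using assms(2,3)
    by (intro ereal_mult_left_mono log_prob_mono finite_measure_mono) auto
qed

lemma scaled_log_small_ball_ge:
  assumes "0 < \<epsilon>" and "exp (- b * \<epsilon> powr (- \<alpha>)) \<le> measure M {\<omega>\<in>space M. N \<omega> \<le> ereal \<epsilon>}"
  shows "ereal (- b) \<le> scaled_log_small_ball M \<alpha> N \<epsilon>"
proof -
  have "ereal (- b) = ereal (\<epsilon> powr \<alpha>) * log_prob (exp (- b * \<epsilon> powr (- \<alpha>)))"
    using assms(1) by (simp add: log_prob_def powr_minus)
  also have "\<dots> \<le> scaled_log_small_ball M \<alpha> N \<epsilon>"
    unfolding scaled_log_small_ball_def using assms(2)
    by (intro ereal_mult_left_mono log_prob_mono) auto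
  finally show ?thesis .
qed

theorem proposition8:
  fixes M :: "'a measure" and Z :: "real \<Rightarrow> 'a \<Rightarrow> real" and \<alpha> \<kappa> :: real
  assumes alpha: "0 < \<alpha>" "\<alpha> < 2"
    and kappa: "0 < \<kappa>"
    and stable: "stable_levy_process M Z \<alpha> \<kappa>"
    and limit_infinity: "\<exists>l. (scaled_log_small_ball M \<alpha> (sup_norm Z) \<longlongrightarrow> l) (at_right 0)"
    and limit_omega: "\<exists>l. (scaled_log_small_ball M \<alpha> (oscillation Z) \<longlongrightarrow> l) (at_right 0)"
    and Shi: "(scaled_log_small_ball M \<alpha> (L2_path_norm Z) \<longlongrightarrow> - gamma_const \<alpha> \<kappa>) (at_right 0)"
  shows "gamma_const \<alpha> \<kappa> \<le> K_infinity M \<alpha> Z \<and>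
    K_infinity M \<alpha> Z \<le> ereal (pi\<^sup>2 / 8 + d_const \<alpha> \<kappa>) \<and>
    K_infinity M \<alpha> Z \<le> K_omega M \<alpha> Z \<and>
    K_omega M \<alpha> Z \<le> ereal (pi\<^sup>2 / 2 + d_const \<alpha> \<kappa>)"
proof -
  note Z = stable_levy_processD(1)[OF stable]
  interpret prob_space M by (rule levy_processD(1)[OF Z])
  \<comment> \<open>These are limits of scaled logarithms, the negatives of the constants, so all
    four inequalities appear below with reversed sign.\<close>
  obtain k w where k: "(scaled_log_small_ball M \<alpha> (sup_norm Z) \<longlongrightarrow> k) (at_right 0)"
    and w: "(scaled_log_small_ball M \<alpha> (oscillation Z) \<longlongrightarrow> w) (at_right 0)"
    using limit_infinity limit_omega by blast
  have K: "K_infinity M \<alpha> Z = - k" "K_omega M \<alpha> Z = - w"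
    unfolding K_infinity_def K_omega_def small_ball_constant_def
    by (simp_all add: tendsto_Lim[OF _ k] tendsto_Lim[OF _ w])
  have pos: "\<forall>\<^sub>F \<epsilon>::real in at_right 0. 0 < \<epsilon>"
    by (simp add: eventually_at_right_less)
  have "k \<le> - gamma_const \<alpha> \<kappa>"
  proof (rule tendsto_le[OF _ Shi k])
    show "\<forall>\<^sub>F \<epsilon> in at_right 0. scaled_log_small_ball M \<alpha> (sup_norm Z) \<epsilon> \<le> scaled_log_small_ball M \<alpha> (L2_path_norm Z) \<epsilon>"
      using pos by (rule eventually_mono)
        (intro scaled_log_small_ball_mono prob_space_axioms L2_path_norm_le_in_sets Z, simp add: L2_path_norm_le)
  qed simp
  moreover have "w \<le> k"
  proof (rule tendsto_le[OF _ k w])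
    \<comment> \<open>Every path starts from 0, so the increment from time 0 is the value
      itself.\<close>
    have "sup_norm Z \<omega> \<le> ereal \<epsilon>" if "oscillation Z \<omega> \<le> ereal \<epsilon>" "\<omega> \<in> space M" "0 < \<epsilon>" for \<omega> \<epsilon>
      using that(1) oscillation_le_iff[of \<epsilon> Z \<omega>] that(3) levy_processD(3)[OF Z that(2)]
      unfolding sup_norm_le_iff by force
    then show "\<forall>\<^sub>F \<epsilon> in at_right 0. scaled_log_small_ball M \<alpha> (oscillation Z) \<epsilon> \<le> scaled_log_small_ball M \<alpha> (sup_norm Z) \<epsilon>"
      using pos by (intro eventually_mono[OF pos] scaled_log_small_ball_mono prob_space_axioms sup_norm_le_in_sets Z)
  qed simp
  moreover have "ereal (- (pi\<^sup>2 / 8 + d_const \<alpha> \<kappa>)) \<le> k"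
  proof -
    have "\<kappa> * (pi / 2) powr \<alpha> \<le> pi\<^sup>2 / 8 + d_const \<alpha> \<kappa>"
      using d_const_ge[OF alpha kappa, of "pi / 2"] by (simp add: power_divide)
    moreover have "ereal (- (\<kappa> * (pi / 2) powr \<alpha>)) \<le> k"
    proof (rule tendsto_lowerbound[OF k])
      have "ereal (- (\<kappa> * (pi / 2) powr \<alpha>)) \<le> scaled_log_small_ball M \<alpha> (sup_norm Z) \<epsilon>" if \<epsilon>: "0 < \<epsilon>" for \<epsilon>
      proof (rule scaled_log_small_ball_ge[OF \<epsilon>])
        have "(pi / (2 * \<epsilon>)) powr \<alpha> = (pi / 2 / \<epsilon>) powr \<alpha>"
          by simp
        also have "\<dots> = (pi / 2) powr \<alpha> * \<epsilon> powr (- \<alpha>)"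
          using \<epsilon> by (subst powr_divide) (simp_all add: powr_minus_divide)
        finally have "- \<kappa> * (pi / (2 * \<epsilon>)) powr \<alpha> = - (\<kappa> * (pi / 2) powr \<alpha>) * \<epsilon> powr - \<alpha>"
          by (simp only: mult_minus_left mult.assoc)
        then show "exp (- (\<kappa> * (pi / 2) powr \<alpha>) * \<epsilon> powr - \<alpha>) \<le> prob {\<omega> \<in> space M. sup_norm Z \<omega> \<le> ereal \<epsilon>}"
          using stable_small_ball_ge[OF alpha kappa stable \<epsilon>] by (simp only:)
      qed
      then show "\<forall>\<^sub>F \<epsilon> in at_right 0. ereal (- (\<kappa> * (pi / 2) powr \<alpha>)) \<le> scaled_log_small_ball M \<alpha> (sup_norm Z) \<epsilon>"
        by (rule eventually_mono[OF pos])
    qed simp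
    ultimately show ?thesis by (meson ereal_less_eq(3) le_imp_neg_le order_trans)
  qed
  moreover have "ereal (- (pi\<^sup>2 / 2 + d_const \<alpha> \<kappa>)) \<le> w"
  proof -
    have "\<kappa> * pi powr \<alpha> \<le> pi\<^sup>2 / 2 + d_const \<alpha> \<kappa>"
      using d_const_ge[OF alpha kappa, of pi] by simp
    moreover have "ereal (- (\<kappa> * pi powr \<alpha>)) \<le> w"
    proof (rule tendsto_lowerbound[OF w])
      have "ereal (- (\<kappa> * pi powr \<alpha>)) \<le> scaled_log_small_ball M \<alpha> (oscillation Z) \<epsilon>" if \<epsilon>: "0 < \<epsilon>" for \<epsilon>
      proof (rule scaled_log_small_ball_ge[OF \<epsilon>])
        \<comment> \<open>Halving the radius doubles the frequency to
          \<open>pi / \<epsilon>\<close>, which turns \<open>pi\<^sup>2 / 8\<close> into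
          \<open>pi\<^sup>2 / 2\<close>.\<close>
        have "(pi / (2 * (\<epsilon> / 2))) powr \<alpha> = (pi / \<epsilon>) powr \<alpha>"
          by simp
        also have "\<dots> = pi powr \<alpha> * \<epsilon> powr (- \<alpha>)"
          using \<epsilon> by (subst powr_divide) (simp_all add: powr_minus_divide)
        finally have "- \<kappa> * (pi / (2 * (\<epsilon> / 2))) powr \<alpha> = - (\<kappa> * pi powr \<alpha>) * \<epsilon> powr - \<alpha>"
          by (simp only: mult_minus_left mult.assoc)
        then have "exp (- (\<kappa> * pi powr \<alpha>) * \<epsilon> powr - \<alpha>) \<le> prob {\<omega> \<in> space M. sup_norm Z \<omega> \<le> ereal (\<epsilon> / 2)}"
          using stable_small_ball_ge[OF alpha kappa stable half_gt_zero[OF \<epsilon>]] by (simp only:)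
        also have "\<dots> \<le> prob {\<omega> \<in> space M. oscillation Z \<omega> \<le> ereal \<epsilon>}"
        proof (rule finite_measure_mono)
          have "\<bar>Z t \<omega> - Z s \<omega>\<bar> \<le> \<epsilon>" if "\<bar>Z t \<omega>\<bar> \<le> \<epsilon> / 2" "\<bar>Z s \<omega>\<bar> \<le> \<epsilon> / 2" for s t \<omega>
            using that by linarith
          then show "{\<omega> \<in> space M. sup_norm Z \<omega> \<le> ereal (\<epsilon> / 2)} \<subseteq> {\<omega> \<in> space M. oscillation Z \<omega> \<le> ereal \<epsilon>}"
            using oscillation_le_iff[of \<epsilon> Z] \<epsilon> by (auto simp: sup_norm_le_iff)
        qed (use oscillation_le_in_sets[OF Z] \<epsilon> in simp)
        finally show "exp (- (\<kappa> * pi powr \<alpha>) * \<epsilon> powr - \<alpha>) \<le> prob {\<omega> \<in> space M. oscillation Z \<omega> \<le> ereal \<epsilon>}" .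
      qed
      then show "\<forall>\<^sub>F \<epsilon> in at_right 0. ereal (- (\<kappa> * pi powr \<alpha>)) \<le> scaled_log_small_ball M \<alpha> (oscillation Z) \<epsilon>"
        by (rule eventually_mono[OF pos])
    qed simp
    ultimately show ?thesis by (meson ereal_less_eq(3) le_imp_neg_le order_trans)
  qed
  ultimately show ?thesis
    unfolding K by (metis ereal_minus_le_minus ereal_uminus_uminus uminus_ereal.simps(1))
qed

end
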